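(* Let $(X,\tau)$ be a Hausdorff definable topological space in $\mathcal{R}$ with $X\subseteq R$. Then there is a finite partition $\mathcal{X}$ of $X$ into points and intervals such that for every $Y\in\mathcal{X}$ the subspace topology $\tau|_Y$ is one of: the euclidean topology on $Y$, the right half-open interval topology $\tau_r$ on $Y$, the left half-open interval topology $\tau_l$ on $Y$, or the discrete topology on $Y$.
   Context: $\mathcal{R}=(R,<,\dots)$ is an arbitrary o-minimal expansion of a dense linear order without endpoints; "definable" means definable in $\mathcal{R}$ with parameters. A definable topological space is a pair $(X,\tau)$ where $X\subseteq R^n$ is definable and $\tau$ is a topology on $X$ with a basis which is a definable family of sets. An interval means an open interval with endpoints in $R\cup\{\pm\infty\}$. The euclidean topology on subsets of $R$ is the (subspace of the) order topology; $\tau_r$ is the topology generated by the sets $[x,y)$, $x<y$ (intersected with the subset), and $\tau_l$ is generated by the sets $(x,y]$, $x<y$. *)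

theory Defs
  imports "HOL-Analysis.Analysis"
begin

section \<open>First-order expansions of a linear order and definability\<close>

text \<open>
  An expansion of the order of \<open>'a\<close> interprets a further (possibly empty) first-order language.
  A symbol belongs to that language iff its arity is defined; the values of an interpretation on
  argument lists of the wrong length, or on symbols outside the language, are never used, by the
  well-formedness conditions below.
\<close>

record ('f, 'r, 'a) expansion =
  fun_arity :: "'f \<Rightarrow> nat option"
  fun_interp :: "'f \<Rightarrow> 'a list \<Rightarrow> 'a"
  rel_arity :: "'r \<Rightarrow> nat option"
  rel_interp :: "'r \<Rightarrow> 'a list \<Rightarrow> bool"

datatype 'f tm = Var nat | Fun 'f "'f tm list"

text \<open>Variables are de Bruijn indices: \<open>Exists\<close> binds index 0 and shifts the other indices.\<close>

datatype ('f, 'r) fm =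
    Eq "'f tm" "'f tm"
  | Less "'f tm" "'f tm"
  | Rel 'r "'f tm list"
  | Neg "('f, 'r) fm"
  | Conj "('f, 'r) fm" "('f, 'r) fm"
  | Exists "('f, 'r) fm"

primrec wf_tm :: "('f, 'r, 'a) expansion \<Rightarrow> 'f tm \<Rightarrow> bool" where
  "wf_tm M (Var i) \<longleftrightarrow> True"
| "wf_tm M (Fun f ts) \<longleftrightarrow> fun_arity M f = Some (length ts) \<and> list_all (wf_tm M) ts"

primrec wf_fm :: "('f, 'r, 'a) expansion \<Rightarrow> ('f, 'r) fm \<Rightarrow> bool" where
  "wf_fm M (Eq s t) \<longleftrightarrow> wf_tm M s \<and> wf_tm M t"
| "wf_fm M (Less s t) \<longleftrightarrow> wf_tm M s \<and> wf_tm M t"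
| "wf_fm M (Rel r ts) \<longleftrightarrow> rel_arity M r = Some (length ts) \<and> list_all (wf_tm M) ts"
| "wf_fm M (Neg \<phi>) \<longleftrightarrow> wf_fm M \<phi>"
| "wf_fm M (Conj \<phi> \<psi>) \<longleftrightarrow> wf_fm M \<phi> \<and> wf_fm M \<psi>"
| "wf_fm M (Exists \<phi>) \<longleftrightarrow> wf_fm M \<phi>"

primrec val_tm :: "('f, 'r, 'a) expansion \<Rightarrow> (nat \<Rightarrow> 'a) \<Rightarrow> 'f tm \<Rightarrow> 'a" where
  "val_tm M e (Var i) = e i"
| "val_tm M e (Fun f ts) = fun_interp M f (map (val_tm M e) ts)"

primrec sat :: "('f, 'r, 'a::linorder) expansion \<Rightarrow> (nat \<Rightarrow> 'a) \<Rightarrow> ('f, 'r) fm \<Rightarrow> bool" where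
  "sat M e (Eq s t) \<longleftrightarrow> val_tm M e s = val_tm M e t"
| "sat M e (Less s t) \<longleftrightarrow> val_tm M e s < val_tm M e t"
| "sat M e (Rel r ts) \<longleftrightarrow> rel_interp M r (map (val_tm M e) ts)"
| "sat M e (Neg \<phi>) \<longleftrightarrow> \<not> sat M e \<phi>"
| "sat M e (Conj \<phi> \<psi>) \<longleftrightarrow> sat M e \<phi> \<and> sat M e \<psi>"
| "sat M e (Exists \<phi>) \<longleftrightarrow> (\<exists>a. sat M (case_nat a e) \<phi>)"

text \<open>
  The cartesian power \<open>R\<^sup>n\<close> consists of the lists of length \<open>n\<close>. In a formula defining a subset
  of \<open>R\<^sup>n\<close>, the variables with index below \<open>n\<close> are the coordinates, and every further free
  variable (only finitely many occur) is a parameter, whose value is given by \<open>p\<close>.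
\<close>

definition power_space :: "nat \<Rightarrow> 'a list set" where
  "power_space n = {xs. length xs = n}"

definition assignment :: "'a list \<Rightarrow> (nat \<Rightarrow> 'a) \<Rightarrow> nat \<Rightarrow> 'a" where
  "assignment xs p i = (if i < length xs then xs ! i else p (i - length xs))"

definition definable :: "('f, 'r, 'a::linorder) expansion \<Rightarrow> nat \<Rightarrow> 'a list set \<Rightarrow> bool" where
  "definable M n A \<longleftrightarrow>
     (\<exists>\<phi> p. wf_fm M \<phi> \<and> A = {xs \<in> power_space n. sat M (assignment xs p) \<phi>})"

definition definable_family ::
  "('f, 'r, 'a::linorder) expansion \<Rightarrow> nat \<Rightarrow> 'a list set set \<Rightarrow> bool" where
  "definable_family M n \<B> \<longleftrightarrow>
     (\<exists>m U D. definable M m U \<and> definable M (m + n) D \<and>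
        \<B> = (\<lambda>u. {x \<in> power_space n. u @ x \<in> D}) ` U)"

section \<open>O-minimality\<close>

definition open_interval :: "'a::linorder set \<Rightarrow> bool" where
  "open_interval I \<longleftrightarrow>
     (\<exists>a b. a < b \<and> I = {a<..<b}) \<or> (\<exists>a. I = {a<..}) \<or> (\<exists>b. I = {..<b}) \<or> I = UNIV"

definition point_or_interval :: "'a::linorder set \<Rightarrow> bool" where
  "point_or_interval Y \<longleftrightarrow> (\<exists>a. Y = {a}) \<or> open_interval Y"

definition o_minimal :: "('f, 'r, 'a::linorder) expansion \<Rightarrow> bool" where
  "o_minimal M \<longleftrightarrow>
     (\<forall>A. definable M 1 ((\<lambda>x. [x]) ` A) \<longrightarrow>
        (\<exists>\<F>. finite \<F> \<and> (\<forall>Y\<in>\<F>. point_or_interval Y) \<and> A = \<Union>\<F>))"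

section \<open>Definable topological spaces\<close>

definition definable_topological_space ::
  "('f, 'r, 'a::linorder) expansion \<Rightarrow> nat \<Rightarrow> 'a list topology \<Rightarrow> bool" where
  "definable_topological_space M n T \<longleftrightarrow>
     definable M n (topspace T) \<and>
     (\<exists>\<B>. definable_family M n \<B> \<and> openin T = arbitrary union_of (\<lambda>B. B \<in> \<B>))"

text \<open>
  A topology on a subset of \<open>R\<close> itself is transported along the identification of \<open>R\<^sup>1\<close>
  with \<open>R\<close>, which maps the one-element list \<open>[x]\<close> to \<open>x\<close>.
\<close>

definition definable_topological_space_line ::
  "('f, 'r, 'a::linorder) expansion \<Rightarrow> 'a topology \<Rightarrow> bool" where
  "definable_topological_space_line M T \<longleftrightarrow>
     definable_topological_space M 1 (pullback_topology (power_space 1) hd T)"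

lemma openin_pullback_line:
  "openin (pullback_topology (power_space 1) hd T) W \<longleftrightarrow> (\<exists>V. openin T V \<and> W = (\<lambda>x. [x]) ` V)"
proof -
  have "hd -` V \<inter> power_space 1 = (\<lambda>x. [x]) ` V" for V :: "'a set"
    by (auto simp: power_space_def length_Suc_conv)
  then show ?thesis
    by (simp add: openin_pullback_topology)
qed

lemma topspace_pullback_line:
  "topspace (pullback_topology (power_space 1) hd T) = (\<lambda>x. [x]) ` topspace T"
  by (auto simp: topspace_pullback_topology power_space_def length_Suc_conv)

definition order_topology_on :: "'a::linorder set \<Rightarrow> 'a topology" where
  "order_topology_on Y =
     subtopology (topology_generated_by (range lessThan \<union> range greaterThan)) Y"

definition right_half_open_topology_on :: "'a::linorder set \<Rightarrow> 'a topology" where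
  "right_half_open_topology_on Y =
     subtopology (topology_generated_by {{x..<y} | x y. x < y}) Y"

definition left_half_open_topology_on :: "'a::linorder set \<Rightarrow> 'a topology" where
  "left_half_open_topology_on Y =
     subtopology (topology_generated_by {{x<..y} | x y. x < y}) Y"

text \<open>
  No topological type class is imposed on the order; if there is one, then the order topology is
  the topology of that class.
\<close>

lemma order_topology_on_eq_top_of_set:
  fixes Y :: "'a::{unbounded_dense_linorder, linorder_topology} set"
  shows "order_topology_on Y = top_of_set Y"
proof -
  have gen: "generate_topology_on S W \<longleftrightarrow> generate_topology S W"
    if "\<Union>S = UNIV" for S :: "'a set set" and W
  proof
    assume "generate_topology_on S W"
    then show "generate_topology S W"
    proof induction
      case Empty
      show ?case using generate_topology.UN[of "{}" S] by simp
    qed (auto intro: generate_topology.intros)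
  next
    assume "generate_topology S W"
    then show "generate_topology_on S W"
    proof induction
      case UNIV
      show ?case using generate_topology_on.UN[of S S] that
        by (auto intro: generate_topology_on.Basis)
    qed (auto intro: generate_topology_on.intros)
  qed
  have "\<Union>(range lessThan \<union> range greaterThan) = (UNIV :: 'a set)"
    using gt_ex by auto
  then have "openin (topology_generated_by (range lessThan \<union> range greaterThan)) W \<longleftrightarrow> open W"
    for W :: "'a set"
    by (metis gen open_generated_order openin_topology_generated_by_iff)
  then have "topology_generated_by (range lessThan \<union> range greaterThan) = (euclidean :: 'a topology)"
    by (simp only: topology_eq open_openin[symmetric]) simp
  then show ?thesis
    by (simp add: order_topology_on_def)
qed

end

theory Submission
  imports Defs
begin

text \<open>
  A basic neighbourhood \<open>A\<close> of a point \<open>x\<close> is definable, so at each \<open>y\<close> it either contains an interval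
  \<open>(y, w)\<close> or misses one. Call \<open>x\<close> adherent to \<open>y\<close> from the right if all basic neighbourhoods of \<open>x\<close>
  contain such an interval; as the topology is Hausdorff, \<open>y\<close> determines \<open>x\<close>. The resulting partial
  function \<open>g\<close>, which sends \<open>y\<close> to \<open>x \<noteq> y\<close>, is piecewise monotone. On a piece where \<open>g\<close> moves all
  points in the same direction, \<open>g\<close> cannot map a point into the same piece: this is immediate if \<open>g\<close> is
  constant or decreasing there. If \<open>g\<close> is increasing, its values contain an interval, in which
  we choose \<open>s = g z\<close>. Points \<open>y\<close> slightly to the right of \<open>s\<close> lie in a given basic neighbourhood \<open>A\<close>
  of \<open>g s\<close> and have the form \<open>y = g z'\<close> with \<open>z'\<close> slightly to the right of \<open>z\<close>. As \<open>A\<close> is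
  a neighbourhood of \<open>y\<close>, it contains points to the right of \<open>z'\<close>; so \<open>A\<close> contains points
  arbitrarily close to \<open>z\<close>, and both \<open>s\<close> and \<open>g s\<close> are adherent to \<open>z\<close>, a contradiction.

  Thus, after removing finitely many points, a point \<open>x\<close> of a piece can be adherent only to \<open>x\<close> itself
  within the piece or at its ends. A compactness argument for definable directed families now shows that the
  trace of the topology on the piece is determined by whether \<open>x\<close> is adherent to itself from the right
  and from the left, and the four combinations give the four topologies.
\<close>

section \<open>Definable predicates on an o-minimal order\<close>

text \<open>Passing the direction as \<open>r\<close> makes the left germ at \<open>y\<close> an
  instance of the right germ in the reversed order.\<close>

definition germ :: "('a \<Rightarrow> 'a \<Rightarrow> bool) \<Rightarrow> 'a \<Rightarrow> ('a \<Rightarrow> bool) \<Rightarrow> bool" where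
  "germ r y A \<longleftrightarrow> (\<exists>w. r y w \<and> (\<forall>z. r y z \<longrightarrow> r z w \<longrightarrow> A z))"

definition is_variable_or_constant :: "((nat \<Rightarrow> 'a) \<Rightarrow> 'a) \<Rightarrow> bool" where
  "is_variable_or_constant t \<longleftrightarrow> (\<exists>i. t = (\<lambda>e. e i)) \<or> (\<exists>c. t = (\<lambda>e. c))"

lemma is_variable_or_constant_intros:
  "is_variable_or_constant (\<lambda>e. e i)" "is_variable_or_constant (\<lambda>e. c)"
  by (auto simp: is_variable_or_constant_def)

locale omin_order = unbounded_dense_linorder leq lt
  for leq :: "'a \<Rightarrow> 'a \<Rightarrow> bool" (infix "\<sqsubseteq>" 50)
    and lt :: "'a \<Rightarrow> 'a \<Rightarrow> bool" (infix "\<sqsubset>" 50) +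
  fixes D :: "((nat \<Rightarrow> 'a) \<Rightarrow> bool) \<Rightarrow> bool"
  assumes D_lt: "D (\<lambda>e. e 0 \<sqsubset> e 1)"
    and D_not: "D P \<Longrightarrow> D (\<lambda>e. \<not> P e)"
    and D_conj: "D P \<Longrightarrow> D Q \<Longrightarrow> D (\<lambda>e. P e \<and> Q e)"
    and D_ex: "D (\<lambda>e. S (\<lambda>i. e (Suc i)) (e 0)) \<Longrightarrow> D (\<lambda>e. \<exists>a. S e a)"
    and D_subst: "D P \<Longrightarrow> (\<And>i. is_variable_or_constant (s i)) \<Longrightarrow> D (\<lambda>e. P (\<lambda>i. s i e))"
    and omin: "D (\<lambda>e. A (e 0)) \<Longrightarrow>
      \<exists>F. finite F \<and> (\<forall>x y. x \<sqsubset> y \<longrightarrow> (\<forall>f\<in>F. \<not> (x \<sqsubseteq> f \<and> f \<sqsubseteq> y)) \<longrightarrow> A x = A y)"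
begin

abbreviation (input) gt :: "'a \<Rightarrow> 'a \<Rightarrow> bool" where "gt x y \<equiv> y \<sqsubset> x"

abbreviation def1 :: "('a \<Rightarrow> bool) \<Rightarrow> bool" where "def1 A \<equiv> D (\<lambda>e. A (e 0))"
abbreviation def2 :: "('a \<Rightarrow> 'a \<Rightarrow> bool) \<Rightarrow> bool" where "def2 E \<equiv> D (\<lambda>e. E (e 0) (e 1))"

text \<open>Through this interpretation every result about the right side of a point is transferred
  to the left side.\<close>

lemma dual: "omin_order (\<lambda>x y. y \<sqsubseteq> x) (\<lambda>x y. y \<sqsubset> x) D"
proof -
  interpret d: linorder "\<lambda>x y. y \<sqsubseteq> x" "\<lambda>x y. y \<sqsubset> x" by (rule dual_linorder)
  show ?thesis
  proof
    show "D (\<lambda>e. e 1 \<sqsubset> e 0)"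
      \<comment> \<open>Truncated subtraction swaps the indices 0 and 1 and sends all others to
        0.\<close>
      using D_subst[OF D_lt, of "\<lambda>i e. e (1 - i)"] by (simp add: is_variable_or_constant_intros)
    show "\<exists>z. z \<sqsubset> x \<and> y \<sqsubset> z" if "y \<sqsubset> x" for x y using dense[OF that] by blast
    show "\<exists>F. finite F \<and>
      (\<forall>x y. y \<sqsubset> x \<longrightarrow> (\<forall>f\<in>F. \<not> (f \<sqsubseteq> x \<and> y \<sqsubseteq> f)) \<longrightarrow> A x = A y)"
      if "D (\<lambda>e. A (e 0))" for A using omin[OF that] by metis
  qed (fact gt_ex lt_ex D_not D_conj D_ex D_subst)+
qed

lemma D_app1:
  assumes "def1 A" "is_variable_or_constant t"
  shows "D (\<lambda>e. A (t e))"
  using D_subst[OF assms(1), of "\<lambda>_. t"] assms(2) by simp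

lemma D_app2:
  assumes "def2 E" "is_variable_or_constant t" "is_variable_or_constant u"
  shows "D (\<lambda>e. E (t e) (u e))"
proof -
  have "is_variable_or_constant (if i = 0 then t else u)" for i :: nat using assms(2,3) by simp
  from D_subst[OF assms(1), of "\<lambda>i. if i = 0 then t else u", OF this] show ?thesis by simp
qed

lemmas D_less = D_app2[OF D_lt]

lemma D_const: "D (\<lambda>e. b)"
proof (cases b)
  case True
  then show ?thesis using D_not[OF D_conj[OF D_lt D_not[OF D_lt]]] by simp
next
  case False
  then show ?thesis using D_conj[OF D_lt D_not[OF D_lt]] by simp
qed

lemma D_disj: "D P \<Longrightarrow> D Q \<Longrightarrow> D (\<lambda>e. P e \<or> Q e)"
  using D_not[OF D_conj[OF D_not D_not], of P Q] by simp

lemma D_imp: "D P \<Longrightarrow> D Q \<Longrightarrow> D (\<lambda>e. P e \<longrightarrow> Q e)"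
  unfolding imp_conv_disj by (intro D_disj D_not)

lemma D_all: "D (\<lambda>e. S (\<lambda>i. e (Suc i)) (e 0)) \<Longrightarrow> D (\<lambda>e. \<forall>a. S e a)"
  using D_not[OF D_ex[OF D_not], of S] by simp

lemma D_eq: "is_variable_or_constant t \<Longrightarrow> is_variable_or_constant u \<Longrightarrow> D (\<lambda>e. t e = u e)"
proof -
  assume "is_variable_or_constant t" "is_variable_or_constant u"
  then have "D (\<lambda>e. \<not> t e \<sqsubset> u e \<and> \<not> u e \<sqsubset> t e)"
    by (intro D_conj D_not D_less)
  moreover have "(\<lambda>e. \<not> t e \<sqsubset> u e \<and> \<not> u e \<sqsubset> t e) = (\<lambda>e. t e = u e)"
    by (auto intro!: ext)
  ultimately show ?thesis by simp
qed

lemmas D_intros = is_variable_or_constant_intros D_less D_eq D_const D_not D_conj D_disj D_imp D_all D_ex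

text \<open>The last entry of the list is bound by the outermost quantifier; the remaining entries
  then keep their indices, and the induction hypothesis applies under that quantifier.\<close>

lemma D_ex_list:
  assumes "D (\<lambda>e. S (\<lambda>i. e (i + m)) (map e [0..<m]))"
  shows "D (\<lambda>e. \<exists>us. length us = m \<and> S e us)"
  using assms
proof (induction m arbitrary: S)
  case 0
  then show ?case by simp
next
  case (Suc m)
  have "D (\<lambda>e. \<exists>us. length us = m \<and> S (\<lambda>i. e (Suc i)) (us @ [e 0]))"
  proof (rule Suc.IH)
    show "D (\<lambda>e. S (\<lambda>i. e (Suc i + m)) (map e [0..<m] @ [e (0 + m)]))"
      using Suc.prems by simp
  qed
  then have "D (\<lambda>e. \<exists>a. \<exists>us. length us = m \<and> S e (us @ [a]))"
    by (intro D_ex)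
  moreover have "(\<exists>a us. length us = m \<and> S e (us @ [a])) \<longleftrightarrow> (\<exists>us. length us = Suc m \<and> S e us)" for e
    by (metis length_append_singleton append_butlast_last_id length_0_conv length_butlast
        diff_Suc_1 nat.distinct(1))
  ultimately show ?case by simp
qed

lemma exists_beyond:
  assumes "finite F"
  shows "\<exists>w. y \<sqsubset> w \<and> (\<forall>f\<in>F. \<not> (y \<sqsubset> f \<and> f \<sqsubseteq> w))"
  using assms
proof induction
  case empty
  then show ?case using gt_ex by auto
next
  case (insert f F)
  then obtain w where w: "y \<sqsubset> w" "\<forall>f\<in>F. \<not> (y \<sqsubset> f \<and> f \<sqsubseteq> w)" by blast
  show ?case
  proof (cases "y \<sqsubset> f")
    case True
    then obtain v where "y \<sqsubset> v" "v \<sqsubset> f" using dense by blast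
    moreover define u where "u = (if v \<sqsubset> w then v else w)"
    ultimately have "y \<sqsubset> u" "u \<sqsubseteq> w" "u \<sqsubset> f" using w by (auto split: if_splits)
    then show ?thesis using w by (intro exI[of _ u]) (use leD le_less_trans order_trans in blast)
  next
    case False
    then show ?thesis using w by blast
  qed
qed

text \<open>On a half-open interval to the right of \<open>y\<close> that misses the exceptional
  points, \<open>A\<close> keeps the value it has at the right end.\<close>

lemma germ_dichotomy:
  assumes "def1 A"
  shows "germ lt y A \<or> germ lt y (\<lambda>z. \<not> A z)"
proof -
  obtain F where F: "finite F"
    "\<And>x y. x \<sqsubset> y \<Longrightarrow> (\<forall>f\<in>F. \<not> (x \<sqsubseteq> f \<and> f \<sqsubseteq> y)) \<Longrightarrow> A x = A y"
    using omin[OF assms] by blast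
  obtain w where w: "y \<sqsubset> w" "\<forall>f\<in>F. \<not> (y \<sqsubset> f \<and> f \<sqsubseteq> w)" using exists_beyond[OF F(1)] by blast
  have "A z = A w" if "y \<sqsubset> z" "z \<sqsubset> w" for z
    using that w by (intro F(2)) (use less_le_trans in blast)+
  then show ?thesis using w(1) unfolding germ_def by (cases "A w") auto
qed

lemma germ_conj: "germ lt y A \<Longrightarrow> germ lt y B \<Longrightarrow> germ lt y (\<lambda>z. A z \<and> B z)"
proof -
  assume "germ lt y A" "germ lt y B"
  then obtain v w where v: "y \<sqsubset> v" "\<forall>z. y \<sqsubset> z \<longrightarrow> z \<sqsubset> v \<longrightarrow> A z"
    and w: "y \<sqsubset> w" "\<forall>z. y \<sqsubset> z \<longrightarrow> z \<sqsubset> w \<longrightarrow> B z" unfolding germ_def by blast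
  show ?thesis
  proof (cases "v \<sqsubset> w")
    case True
    then show ?thesis unfolding germ_def using v w by (meson less_trans)
  next
    case False
    then show ?thesis unfolding germ_def using v w by (meson less_le_trans not_less)
  qed
qed

lemma germ_mono: "germ lt y A \<Longrightarrow> (\<And>z. y \<sqsubset> z \<Longrightarrow> A z \<Longrightarrow> B z) \<Longrightarrow> germ lt y B"
  unfolding germ_def by blast

lemma germ_less: "y \<sqsubset> w \<Longrightarrow> germ lt y (\<lambda>z. z \<sqsubset> w)"
  unfolding germ_def by blast

lemma germ_ex: "germ lt y A \<Longrightarrow> \<exists>z. y \<sqsubset> z \<and> A z"
  unfolding germ_def using dense by blast

lemma germ_ex_below:
  assumes "germ lt y A" "y \<sqsubset> w"
  obtains z where "y \<sqsubset> z" "z \<sqsubset> w" "A z"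
  using germ_ex[OF germ_conj[OF assms(1) germ_less[OF assms(2)]]] by blast

text \<open>By the dichotomy, the only alternative is an interval to the right of \<open>y\<close>
  that misses \<open>A\<close>.\<close>

lemma germ_cofinal:
  assumes "def1 A" "\<And>w. y \<sqsubset> w \<Longrightarrow> \<exists>z. y \<sqsubset> z \<and> z \<sqsubset> w \<and> A z"
  shows "germ lt y A"
  using germ_dichotomy[OF assms(1), of y] assms(2) unfolding germ_def by blast

text \<open>The order need not be complete; o-minimality supplies the supremum. The downward closure
  \<open>C\<close> of \<open>A\<close> changes only at exceptional points. Take \<open>p\<close> in
  \<open>C\<close> at or above all exceptional points of \<open>C\<close>, and \<open>q\<close>
  outside \<open>C\<close> at or below all the others. Then \<open>C\<close> is constant strictly
  between \<open>p\<close> and \<open>q\<close>, and one of these two is the supremum.\<close>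

lemma exists_sup:
  assumes "def1 A" "A a" "\<And>z. A z \<Longrightarrow> z \<sqsubseteq> u"
  obtains s where "\<And>z. A z \<Longrightarrow> z \<sqsubseteq> s" "\<And>t. t \<sqsubset> s \<Longrightarrow> \<exists>z. A z \<and> t \<sqsubset> z"
proof -
  define C where "C z \<longleftrightarrow> (\<exists>x. \<not> x \<sqsubset> z \<and> A x)" for z
  have "def1 C" unfolding C_def by (intro D_intros D_app1[OF assms(1)])
  then obtain F where F: "finite F"
    "\<And>x y. x \<sqsubset> y \<Longrightarrow> (\<forall>f\<in>F. \<not> (x \<sqsubseteq> f \<and> f \<sqsubseteq> y)) \<Longrightarrow> C x = C y"
    using omin by blast
  show ?thesis
  \<comment> \<open>An upper bound in \<open>A\<close> is its maximum; otherwise \<open>u\<close>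
    lies outside the downward closure.\<close>
  proof (cases "A u")
    case True
    then show ?thesis using assms that by blast
  next
    case False
    have Cu: "\<not> C u" unfolding C_def using False assms(3) le_imp_less_or_eq by blast
    have Ca: "C a" unfolding C_def using assms(2) by blast
    have Cdown: "C y \<Longrightarrow> x \<sqsubseteq> y \<Longrightarrow> C x" for x y unfolding C_def by (meson le_less_trans not_less)
    have "\<exists>p. C p \<and> (\<forall>f\<in>G. C f \<longrightarrow> f \<sqsubseteq> p)" if "finite G" for G
      using that
    proof induction
      case empty
      then show ?case using Ca by auto
    next
      case (insert f G)
      then obtain p where "C p" "\<forall>f\<in>G. C f \<longrightarrow> f \<sqsubseteq> p" by blast
      then show ?case by (cases "C f \<and> p \<sqsubset> f") (blast intro: order_trans less_imp_le leI)+
    qed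
    then obtain p where p: "C p" "\<And>f. f \<in> F \<Longrightarrow> C f \<Longrightarrow> f \<sqsubseteq> p" using F(1) by blast
    have "\<exists>q. \<not> C q \<and> (\<forall>f\<in>G. \<not> C f \<longrightarrow> q \<sqsubseteq> f)" if "finite G" for G
      using that
    proof induction
      case empty
      then show ?case using Cu by auto
    next
      case (insert f G)
      then obtain q where "\<not> C q" "\<forall>f\<in>G. \<not> C f \<longrightarrow> q \<sqsubseteq> f" by blast
      then show ?case by (cases "\<not> C f \<and> f \<sqsubset> q") (blast intro: order_trans less_imp_le leI)+
    qed
    then obtain q where q: "\<not> C q" "\<And>f. f \<in> F \<Longrightarrow> \<not> C f \<Longrightarrow> q \<sqsubseteq> f" using F(1) by blast
    have "p \<sqsubset> q" using p(1) q(1) Cdown not_less by blast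
    then obtain r where r: "p \<sqsubset> r" "r \<sqsubset> q" using dense by blast
    have const: "C x = C y" if "p \<sqsubset> x" "x \<sqsubset> y" "y \<sqsubset> q" for x y
      proof (intro F(2) that ballI notI)
      fix f assume "f \<in> F" "x \<sqsubseteq> f \<and> f \<sqsubseteq> y"
      then have "f \<sqsubseteq> p \<or> q \<sqsubseteq> f" "x \<sqsubseteq> f" "f \<sqsubseteq> y" using p(2) q(2) by blast+
      then show False using that less_le_trans le_less_trans less_irrefl by blast
    qed
    have eq: "C x = C r" if "p \<sqsubset> x" "x \<sqsubset> q" for x
      using const[of x r] const[of r x] that r less_linear[of x r] by metis
    have A_C: "A z \<Longrightarrow> C z" for z unfolding C_def by blast
    show ?thesis
    \<comment> \<open>The constant value of \<open>C\<close> between \<open>p\<close> and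
      \<open>q\<close> decides which of the two ends is the supremum.\<close>
    proof (cases "C r")
      case True
      show ?thesis
      proof (rule that[of q])
        show "z \<sqsubseteq> q" if "A z" for z using that A_C Cdown q(1) le_cases by blast
        fix t assume "t \<sqsubset> q"
        then obtain v where v: "(if p \<sqsubset> t then t else p) \<sqsubset> v" "v \<sqsubset> q"
          using dense \<open>p \<sqsubset> q\<close> by (metis (full_types))
        then have "C v" "t \<sqsubset> v" using eq[of v] True by (auto split: if_splits)
        then show "\<exists>z. A z \<and> t \<sqsubset> z" unfolding C_def by (meson less_le_trans not_less)
      qed
    next
      case False
      show ?thesis
      proof (rule that[of p])
        show "z \<sqsubseteq> p" if "A z" for z
        proof (rule ccontr)
          assume "\<not> z \<sqsubseteq> p"
          then have "p \<sqsubset> z" by auto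
          moreover have "z \<sqsubset> q" using A_C[OF that] Cdown[of z q] q(1) not_less by blast
          ultimately show False using eq[of z] A_C[OF that] False by blast
        qed
        fix t assume "t \<sqsubset> p"
        then show "\<exists>z. A z \<and> t \<sqsubset> z" using p(1) unfolding C_def by (meson less_le_trans not_less)
      qed
    qed
  qed
qed

end

section \<open>Left-hand versions and induction along an interval\<close>

context omin_order
begin

lemmas germ_gt_dichotomy = omin_order.germ_dichotomy[OF dual]
lemmas germ_gt_conj = omin_order.germ_conj[OF dual]
lemmas germ_gt_mono = omin_order.germ_mono[OF dual]
lemmas germ_gt_less = omin_order.germ_less[OF dual]
lemmas germ_gt_ex = omin_order.germ_ex[OF dual]
lemmas germ_gt_ex_above = omin_order.germ_ex_below[OF dual]
lemmas germ_gt_cofinal = omin_order.germ_cofinal[OF dual]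
lemmas exists_inf = omin_order.exists_sup[OF dual]
lemmas exists_before = omin_order.exists_beyond[OF dual]

text \<open>Let \<open>s\<close> be the infimum of the points between \<open>a\<close> and
  \<open>b\<close> where \<open>P\<close> fails. Then \<open>P\<close> holds just to the left of
  \<open>s\<close>, so by \<open>step\<close> also at \<open>s\<close> and just to its right, which
  contradicts the choice of \<open>s\<close>.\<close>

lemma interval_induct:
  assumes P: "def1 P" and start: "germ lt a P"
    and step: "\<And>s. a \<sqsubset> s \<Longrightarrow> s \<sqsubset> b \<Longrightarrow> germ gt s P \<Longrightarrow> P s \<and> germ lt s P"
    and z: "a \<sqsubset> z" "z \<sqsubset> b"
  shows "P z"
proof (rule ccontr)
  assume nPz: "\<not> P z"
  define A where "A x \<longleftrightarrow> a \<sqsubset> x \<and> x \<sqsubset> b \<and> \<not> P x" for x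
  have "def1 A" unfolding A_def by (intro D_intros D_app1[OF P])
  moreover have "A z" unfolding A_def using nPz z by blast
  moreover have "\<And>x. A x \<Longrightarrow> a \<sqsubseteq> x" unfolding A_def by auto
  ultimately obtain s where s: "\<And>x. A x \<Longrightarrow> s \<sqsubseteq> x" "\<And>t. s \<sqsubset> t \<Longrightarrow> \<exists>x. A x \<and> x \<sqsubset> t"
    using exists_inf[of A z a] by metis
  obtain w where w: "a \<sqsubset> w" "\<And>x. a \<sqsubset> x \<Longrightarrow> x \<sqsubset> w \<Longrightarrow> P x" using start unfolding germ_def by blast
  \<comment> \<open>The germ of \<open>P\<close> at \<open>a\<close> keeps the infimum away from
    \<open>a\<close>.\<close>
  have "a \<sqsubset> s"
  proof (rule ccontr)
    assume "\<not> a \<sqsubset> s"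
    then have "s \<sqsubset> w" using w(1) by order
    then obtain x where "A x" "x \<sqsubset> w" using s(2) by blast
    then show False unfolding A_def using w(2) by blast
  qed
  have "s \<sqsubset> b" using s(1)[OF \<open>A z\<close>] z(2) by order
  have "germ gt s P" unfolding germ_def
  proof (intro exI conjI allI impI)
    show "a \<sqsubset> s" by fact
    fix x assume "x \<sqsubset> s" "a \<sqsubset> x"
    then have "\<not> A x" using s(1)[of x] by auto
    then show "P x" unfolding A_def using \<open>a \<sqsubset> x\<close> \<open>x \<sqsubset> s\<close> \<open>s \<sqsubset> b\<close> less_trans by blast
  qed
  with step \<open>a \<sqsubset> s\<close> \<open>s \<sqsubset> b\<close> have Ps: "P s" "germ lt s P" by auto
  then obtain v where v: "s \<sqsubset> v" "\<And>x. s \<sqsubset> x \<Longrightarrow> x \<sqsubset> v \<Longrightarrow> P x" unfolding germ_def by blast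
  obtain x where "A x" "x \<sqsubset> v" using s(2)[OF v(1)] by blast
  moreover have "s \<sqsubseteq> x" using s(1)[OF \<open>A x\<close>] .
  ultimately show False using v(2)[of x] Ps(1) unfolding A_def by (cases "s = x") auto
qed

text \<open>Interval induction on \<open>E x\<close>. Stating it for a transitive relation lets it
  serve increasing, decreasing and constant functions alike.\<close>

lemma locally_increasing:
  assumes E: "def2 E" and trans: "\<And>x y z. E x y \<Longrightarrow> E y z \<Longrightarrow> E x z"
    and loc: "\<And>y. p \<sqsubset> y \<Longrightarrow> y \<sqsubset> q \<Longrightarrow> germ lt y (E y) \<and> germ gt y (\<lambda>z. E z y)"
    and xy: "p \<sqsubset> x" "x \<sqsubset> y" "y \<sqsubset> q"
  shows "E x y"
proof (rule interval_induct[of "E x"])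
  show "def1 (E x)" by (intro D_app2[OF E] D_intros)
  show "germ lt x (E x)" using loc[of x] xy less_trans by blast
  show "x \<sqsubset> y" "y \<sqsubset> q" by fact+
  fix s assume s: "x \<sqsubset> s" "s \<sqsubset> q" "germ gt s (E x)"
  then have ls: "germ lt s (E s)" "germ gt s (\<lambda>z. E z s)" using loc[of s] xy less_trans by blast+
  have "E x s" using germ_gt_ex[OF germ_gt_conj[OF s(3) ls(2)]] trans by blast
  moreover have "germ lt s (E x)" using germ_mono[OF ls(1)] trans[OF \<open>E x s\<close>] by blast
  ultimately show "E x s \<and> germ lt s (E x)" by blast
qed

end

section \<open>Monotonicity\<close>

text \<open>
  A function \<open>g\<close> enters only through the relation \<open>E x y \<longleftrightarrow> g x \<sqsubset> g y\<close>, so that the orders on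
  its domain and on its values can be reversed independently.
\<close>

locale omin_weak_order = omin_order +
  fixes E :: "'a \<Rightarrow> 'a \<Rightarrow> bool"
  assumes E: "def2 E"
    and E_trans: "\<And>x y z. E x y \<Longrightarrow> E y z \<Longrightarrow> E x z"
    and E_irrefl: "\<And>x. \<not> E x x"
    and E_negtrans: "\<And>x y z. \<not> E x y \<Longrightarrow> \<not> E y z \<Longrightarrow> \<not> E x z"
begin

lemma dual_order: "omin_weak_order (\<lambda>x y. y \<sqsubseteq> x) (\<lambda>x y. y \<sqsubset> x) D E"
proof -
  interpret d: omin_order "\<lambda>x y. y \<sqsubseteq> x" "\<lambda>x y. y \<sqsubset> x" D by (rule dual)
  show ?thesis by unfold_locales (fact E E_irrefl | fact E_trans | fact E_negtrans)+
qed

lemma converse_order: "omin_weak_order leq lt D (\<lambda>x y. E y x)"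
proof unfold_locales
  show "def2 (\<lambda>x y. E y x)" by (intro D_intros D_app2[OF E])
  show "E z x" if "E y x" "E z y" for x y z using E_trans that by blast
  show "\<not> E z x" if "\<not> E y x" "\<not> E z y" for x y z using E_negtrans that by blast
qed (fact E_irrefl)

text \<open>
  If all points of an interval were strict local minima, the values would drop at all points close to
  the right end of any subinterval and, by reflection, rise at all points close to its left end.
\<close>

definition drops_at :: "'a \<Rightarrow> bool" where
  "drops_at y \<longleftrightarrow> (\<exists>a. germ gt y (E a) \<and> germ lt y (\<lambda>z. \<not> E a z))"

lemma def1_drops_at: "def1 drops_at"
  unfolding drops_at_def germ_def by (intro D_intros D_app2[OF E])

text \<open>For \<open>a\<close> close to \<open>q\<close>, the values near \<open>q\<close> do not
  exceed the value at \<open>a\<close>, whereas the values just to the right of \<open>a\<close> do.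
  The supremum \<open>b\<close> of the points with values above that at \<open>a\<close> is
  therefore below \<open>q\<close>, and the values drop at \<open>b\<close>. As \<open>a\<close> may
  be taken arbitrarily close to \<open>q\<close>, such points are cofinal.\<close>

lemma local_min_drops:
  assumes pq: "p \<sqsubset> q"
    and loc: "\<And>y. p \<sqsubset> y \<Longrightarrow> y \<sqsubset> q \<Longrightarrow> germ lt y (E y) \<and> germ gt y (E y)"
  shows "germ gt q drops_at"
proof -
  \<comment> \<open>Otherwise the values would increase near \<open>q\<close>, and the points there
    would not be local minima from the left.\<close>
  have "\<not> germ gt q (\<lambda>x. \<forall>y. x \<sqsubset> y \<longrightarrow> y \<sqsubset> q \<longrightarrow> E x y)"
  proof
    assume "germ gt q (\<lambda>x. \<forall>y. x \<sqsubset> y \<longrightarrow> y \<sqsubset> q \<longrightarrow> E x y)"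
    then have "germ gt q (\<lambda>x. p \<sqsubset> x \<and> (\<forall>y. x \<sqsubset> y \<longrightarrow> y \<sqsubset> q \<longrightarrow> E x y))"
      using germ_gt_conj[OF germ_gt_less[OF pq]] by blast
    then obtain w where w: "w \<sqsubset> q" "\<And>x. x \<sqsubset> q \<Longrightarrow> w \<sqsubset> x \<Longrightarrow> p \<sqsubset> x \<and> (\<forall>y. x \<sqsubset> y \<longrightarrow> y \<sqsubset> q \<longrightarrow> E x y)"
      unfolding germ_def by blast
    then obtain y where y: "w \<sqsubset> y" "y \<sqsubset> q" using dense by blast
    then have "germ gt y (E y)" using loc w(2) by blast
    then obtain z where "z \<sqsubset> y" "w \<sqsubset> z" "E y z" using germ_gt_ex_above y(1) by blast
    then show False using w(2)[of z] y E_trans E_irrefl less_trans by blast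
  qed
  moreover have "germ gt q (\<lambda>x. \<forall>y. x \<sqsubset> y \<longrightarrow> y \<sqsubset> q \<longrightarrow> E x y) \<or>
      germ gt q (\<lambda>x. \<not> (\<forall>y. x \<sqsubset> y \<longrightarrow> y \<sqsubset> q \<longrightarrow> E x y))"
    by (intro germ_gt_dichotomy D_intros D_app2[OF E])
  ultimately have "germ gt q (\<lambda>x. p \<sqsubset> x \<and> (\<exists>y. x \<sqsubset> y \<and> y \<sqsubset> q \<and> \<not> E x y))"
    using germ_gt_conj[OF germ_gt_less[OF pq]] by simp
  then obtain w where wq: "w \<sqsubset> q"
    and w: "\<And>x. x \<sqsubset> q \<Longrightarrow> w \<sqsubset> x \<Longrightarrow> p \<sqsubset> x \<and> (\<exists>y. x \<sqsubset> y \<and> y \<sqsubset> q \<and> \<not> E x y)"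
    unfolding germ_def by blast
  have cofinal: "germ gt q (\<lambda>z. \<not> E a z)" if a: "w \<sqsubset> a" "a \<sqsubset> q" for a
  proof -
    define W where "W z \<longleftrightarrow> a \<sqsubset> z \<and> z \<sqsubset> q \<and> \<not> E a z" for z
    have defW: "def1 W" unfolding W_def by (intro D_intros D_app2[OF E])
    obtain e where "W e" unfolding W_def using w a by blast
    moreover have "\<And>z. W z \<Longrightarrow> z \<sqsubseteq> q" unfolding W_def by auto
    ultimately obtain d where d: "\<And>z. W z \<Longrightarrow> z \<sqsubseteq> d" "\<And>t. t \<sqsubset> d \<Longrightarrow> \<exists>z. W z \<and> t \<sqsubset> z"
      using exists_sup[OF defW] by metis
    have "a \<sqsubset> d" using d(1)[OF \<open>W e\<close>] \<open>W e\<close> unfolding W_def by (blast intro: less_le_trans)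
    \<comment> \<open>Suppose \<open>d\<close> is before \<open>q\<close>. If its value exceeds that
      at \<open>a\<close>, so do the values just to its left, as \<open>d\<close> is a local
      minimum, and \<open>W\<close> does not approach \<open>d\<close>. If not, a later point whose
      value is at most that at \<open>d\<close> belongs to \<open>W\<close> as well.\<close>
    have "\<not> d \<sqsubset> q"
    proof
      assume "d \<sqsubset> q"
      show False
      proof (cases "E a d")
        case True
        have "germ gt d (E d)" using loc[of d] w[of d] \<open>d \<sqsubset> q\<close> a(1) \<open>a \<sqsubset> d\<close> less_trans by blast
        then obtain v where v: "v \<sqsubset> d" "\<And>z. z \<sqsubset> d \<Longrightarrow> v \<sqsubset> z \<Longrightarrow> E d z" unfolding germ_def by blast
        obtain z where z: "W z" "v \<sqsubset> z" using d(2)[OF v(1)] by blast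
        then have "z \<noteq> d" unfolding W_def using True by blast
        then have "z \<sqsubset> d" using d(1)[OF z(1)] by simp
        then show False using v(2) z True E_trans unfolding W_def by blast
      next
        case False
        obtain y where y: "d \<sqsubset> y" "y \<sqsubset> q" "\<not> E d y"
          using w[of d] \<open>d \<sqsubset> q\<close> a(1) \<open>a \<sqsubset> d\<close> less_trans by blast
        then have "W y" unfolding W_def using False E_negtrans \<open>a \<sqsubset> d\<close> less_trans by blast
        then show False using d(1) y(1) by (meson leD)
      qed
    qed
    have "germ gt q W"
    proof (rule germ_gt_cofinal[OF defW])
      fix t assume "t \<sqsubset> q"
      then have "t \<sqsubset> d" using \<open>\<not> d \<sqsubset> q\<close> by order
      then show "\<exists>z. z \<sqsubset> q \<and> t \<sqsubset> z \<and> W z" using d(2) unfolding W_def by blast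
    qed
    then show ?thesis by (rule germ_gt_mono) (simp add: W_def)
  qed
  show ?thesis
  proof (rule germ_gt_cofinal[OF def1_drops_at])
    fix t assume "t \<sqsubset> q"
    define u where "u = (if w \<sqsubset> t then t else w)"
    have "u \<sqsubset> q" "w \<sqsubseteq> u" "t \<sqsubseteq> u" using \<open>t \<sqsubset> q\<close> wq unfolding u_def by auto
    then obtain a where a: "u \<sqsubset> a" "a \<sqsubset> q" using dense by blast
    then have wa: "w \<sqsubset> a" and ta: "t \<sqsubset> a" using \<open>w \<sqsubseteq> u\<close> \<open>t \<sqsubseteq> u\<close> le_less_trans by blast+
    obtain r where r: "r \<sqsubset> q" "\<And>z. z \<sqsubset> q \<Longrightarrow> r \<sqsubset> z \<Longrightarrow> \<not> E a z"
      using cofinal[OF wa a(2)] unfolding germ_def by blast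
    define V where "V z \<longleftrightarrow> a \<sqsubset> z \<and> z \<sqsubset> q \<and> E a z" for z
    have defV: "def1 V" unfolding V_def by (intro D_intros D_app2[OF E])
    have "germ lt a (E a)" using loc w[OF a(2) wa] a(2) by blast
    then obtain e where "V e" unfolding V_def using germ_ex_below[OF _ a(2)] by metis
    moreover have Vr: "z \<sqsubseteq> r" if "V z" for z
      using r(2)[of z] that unfolding V_def by (meson not_less)
    ultimately obtain b where b: "\<And>z. V z \<Longrightarrow> z \<sqsubseteq> b" "\<And>t. t \<sqsubset> b \<Longrightarrow> \<exists>z. V z \<and> t \<sqsubset> z"
      using exists_sup[OF defV] by metis
    have ab: "a \<sqsubset> b" using b(1)[OF \<open>V e\<close>] \<open>V e\<close> unfolding V_def by (blast intro: less_le_trans)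
    have "\<not> r \<sqsubset> b" using b(2)[of r] Vr by (meson leD)
    then have bq: "b \<sqsubset> q" using r(1) by order
    have pb: "p \<sqsubset> b" using w[of b] bq wa ab less_trans by blast
    \<comment> \<open>If the value at \<open>b\<close> exceeded that at \<open>a\<close>, the local
      minimum at \<open>b\<close> would extend \<open>V\<close> beyond its supremum.\<close>
    have nab: "\<not> E a b"
    proof
      assume "E a b"
      moreover obtain z where "b \<sqsubset> z" "z \<sqsubset> q" "E b z"
        using loc[OF pb bq] germ_ex_below[OF _ bq] by metis
      ultimately have "V z" unfolding V_def using E_trans ab less_trans by blast
      then show False using b(1) \<open>b \<sqsubset> z\<close> by (meson leD)
    qed
    have "germ gt b V"
    proof (rule germ_gt_cofinal[OF defV])
      fix t assume "t \<sqsubset> b"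
      then obtain z where z: "V z" "t \<sqsubset> z" using b(2) by blast
      then have "z \<noteq> b" unfolding V_def using nab by blast
      then show "\<exists>z. z \<sqsubset> b \<and> t \<sqsubset> z \<and> V z" using z b(1)[OF z(1)] by (metis le_less)
    qed
    then have "germ gt b (E a)" by (rule germ_gt_mono) (simp add: V_def)
    moreover have "germ lt b (\<lambda>z. \<not> E a z)" unfolding germ_def
    proof (intro exI conjI allI impI notI)
      show "b \<sqsubset> q" by fact
      fix z assume "b \<sqsubset> z" "z \<sqsubset> q" "E a z"
      then have "V z" unfolding V_def using ab less_trans by blast
      then show False using b(1) \<open>b \<sqsubset> z\<close> by (meson leD)
    qed
    ultimately have "drops_at b" unfolding drops_at_def by blast
    then show "\<exists>z. z \<sqsubset> q \<and> t \<sqsubset> z \<and> drops_at z" using bq ta ab less_trans by blast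
  qed
qed

text \<open>All points of an interval ending at \<open>q\<close> are drops; the reflected lemma,
  applied to that interval, yields a drop \<open>y\<close> at which the values also rise. To the
  right of \<open>y\<close> the values exceed that at \<open>a\<close> and are at most that at
  \<open>b\<close>; to the left it is the other way round. So the values at \<open>a\<close> and
  \<open>b\<close> would each be smaller than the other.\<close>

lemma no_interval_of_local_minima:
  assumes pq: "p \<sqsubset> q"
    and loc: "\<And>y. p \<sqsubset> y \<Longrightarrow> y \<sqsubset> q \<Longrightarrow> germ lt y (E y) \<and> germ gt y (E y)"
  shows False
proof -
  interpret d: omin_weak_order "\<lambda>x y. y \<sqsubseteq> x" "\<lambda>x y. y \<sqsubset> x" D E by (rule dual_order)
  have "germ gt q (\<lambda>y. p \<sqsubset> y \<and> drops_at y)"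
    using germ_gt_conj[OF germ_gt_less[OF pq] local_min_drops[OF pq loc]] by blast
  then obtain w where w: "w \<sqsubset> q" "\<And>y. y \<sqsubset> q \<Longrightarrow> w \<sqsubset> y \<Longrightarrow> p \<sqsubset> y \<and> drops_at y"
    unfolding germ_def by blast
  have "germ lt w d.drops_at"
  proof (rule d.local_min_drops)
    show "w \<sqsubset> q" by fact
  qed (use loc w in blast)
  then obtain y where "w \<sqsubset> y" "y \<sqsubset> q" "d.drops_at y" using germ_ex_below w(1) by blast
  then obtain a b where "germ lt y (E a)" "germ gt y (\<lambda>z. \<not> E a z)"
    "germ gt y (E b)" "germ lt y (\<lambda>z. \<not> E b z)"
    using w(2) unfolding drops_at_def d.drops_at_def by blast
  then obtain l r where "E a l" "\<not> E b l" "E b r" "\<not> E a r"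
    using germ_ex[OF germ_conj, of y "E a" "\<lambda>z. \<not> E b z"]
      germ_gt_ex[OF germ_gt_conj, of y "E b" "\<lambda>z. \<not> E a z"] by blast
  then show False using E_trans E_negtrans by metis
qed

lemma germ_trichotomy:
  "germ lt y (E y) \<or> germ lt y (\<lambda>z. E z y) \<or> germ lt y (\<lambda>z. \<not> E y z \<and> \<not> E z y)"
proof -
  have "germ lt y (E y) \<or> germ lt y (\<lambda>z. \<not> E y z)"
    by (intro germ_dichotomy D_intros D_app2[OF E])
  moreover have "germ lt y (\<lambda>z. E z y) \<or> germ lt y (\<lambda>z. \<not> E z y)"
    by (intro germ_dichotomy D_intros D_app2[OF E])
  ultimately show ?thesis using germ_conj by blast
qed

end

context omin_order
begin

lemma omin_pieces:
  assumes "finite I" "\<And>A. A \<in> I \<Longrightarrow> def1 A"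
  shows "\<exists>F. finite F \<and> (\<forall>A\<in>I. \<forall>x y. x \<sqsubset> y \<longrightarrow> (\<forall>f\<in>F. \<not> (x \<sqsubseteq> f \<and> f \<sqsubseteq> y)) \<longrightarrow> A x = A y)"
proof -
  have "\<forall>A\<in>I. \<exists>F. finite F \<and> (\<forall>x y. x \<sqsubset> y \<longrightarrow> (\<forall>f\<in>F. \<not> (x \<sqsubseteq> f \<and> f \<sqsubseteq> y)) \<longrightarrow> A x = A y)"
    using omin assms(2) by blast
  then obtain G where "\<forall>A\<in>I. finite (G A) \<and>
      (\<forall>x y. x \<sqsubset> y \<longrightarrow> (\<forall>f\<in>G A. \<not> (x \<sqsubseteq> f \<and> f \<sqsubseteq> y)) \<longrightarrow> A x = A y)"
    by metis
  moreover from this have "finite (\<Union>(G ` I))" using assms(1) by blast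
  ultimately show ?thesis by (intro exI[of _ "\<Union>(G ` I)"] conjI ballI) blast+
qed

end

context omin_weak_order
begin

text \<open>The names \<open>ru\<close> to \<open>le\<close> combine a side of \<open>y\<close>
  (right, left) with the position of the nearby values relative to the value at \<open>y\<close>
  (up, down, equal). Where these six predicates are constant, equality on one side forces it on the
  other (\<open>noteq\<close>, \<open>noteq'\<close>), and points cannot all be strict local
  extrema. The three remaining combinations spread over the piece by
  \<open>locally_increasing\<close>.\<close>

theorem monotonicity:
  "\<exists>F. finite F \<and> (\<forall>p q. p \<sqsubset> q \<longrightarrow> (\<forall>f\<in>F. \<not> (p \<sqsubset> f \<and> f \<sqsubset> q)) \<longrightarrow>
     (\<forall>x y. p \<sqsubset> x \<longrightarrow> x \<sqsubset> y \<longrightarrow> y \<sqsubset> q \<longrightarrow> E x y) \<or>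
     (\<forall>x y. p \<sqsubset> x \<longrightarrow> x \<sqsubset> y \<longrightarrow> y \<sqsubset> q \<longrightarrow> E y x) \<or>
     (\<forall>x y. p \<sqsubset> x \<longrightarrow> x \<sqsubset> y \<longrightarrow> y \<sqsubset> q \<longrightarrow> \<not> E x y \<and> \<not> E y x))"
proof -
  interpret d: omin_weak_order "\<lambda>x y. y \<sqsubseteq> x" "\<lambda>x y. y \<sqsubset> x" D E by (rule dual_order)
  interpret c: omin_weak_order leq lt D "\<lambda>x y. E y x" by (rule converse_order)
  define ru where "ru y \<longleftrightarrow> germ lt y (E y)" for y
  define rd where "rd y \<longleftrightarrow> germ lt y (\<lambda>z. E z y)" for y
  define re where "re y \<longleftrightarrow> germ lt y (\<lambda>z. \<not> E y z \<and> \<not> E z y)" for y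
  define lu where "lu y \<longleftrightarrow> germ gt y (E y)" for y
  define ld where "ld y \<longleftrightarrow> germ gt y (\<lambda>z. E z y)" for y
  define le where "le y \<longleftrightarrow> germ gt y (\<lambda>z. \<not> E y z \<and> \<not> E z y)" for y
  define I where "I = {ru, rd, re, lu, ld, le}"
  have "def1 A" if "A \<in> I" for A
  proof -
    have "def1 ru" "def1 rd" "def1 re" "def1 lu" "def1 ld" "def1 le"
      unfolding ru_def rd_def re_def lu_def ld_def le_def germ_def
      by (intro D_intros D_app2[OF E])+
    then show ?thesis using that unfolding I_def by blast
  qed
  then obtain F where F: "finite F"
    "\<And>A x y. A \<in> I \<Longrightarrow> x \<sqsubset> y \<Longrightarrow> (\<forall>f\<in>F. \<not> (x \<sqsubseteq> f \<and> f \<sqsubseteq> y)) \<Longrightarrow> A x = A y"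
    using omin_pieces[of I] unfolding I_def by (metis finite.emptyI finite.insertI)
  show ?thesis
  proof (intro exI[of _ F] conjI allI impI)
    fix p q assume pq: "p \<sqsubset> q" and avoid: "\<forall>f\<in>F. \<not> (p \<sqsubset> f \<and> f \<sqsubset> q)"
    obtain m where m: "p \<sqsubset> m" "m \<sqsubset> q" using dense[OF pq] by blast
    have const: "A x = A m" if "A \<in> I" "p \<sqsubset> x" "x \<sqsubset> q" for A x
    proof -
      have "A x = A y" if "x \<sqsubset> y" "p \<sqsubset> x" "y \<sqsubset> q" for x y
        using that avoid less_le_trans le_less_trans by (intro F(2)[OF \<open>A \<in> I\<close>]) blast+
      then show ?thesis using that m less_linear[of x m] by metis
    qed
    have types: "ru m \<or> rd m \<or> re m" "lu m \<or> ld m \<or> le m"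
      unfolding ru_def rd_def re_def lu_def ld_def le_def
      using germ_trichotomy d.germ_trichotomy by blast+
    \<comment> \<open>The values are constant on an interval to the right of \<open>m\<close>, yet a
      point \<open>v\<close> of it would, like \<open>m\<close>, have strictly different values
      close to its left.\<close>
    have noteq: False if "re m" "lu m \<or> ld m"
    proof -
      have "germ lt m (\<lambda>z. \<not> E m z \<and> \<not> E z m)" using that(1) unfolding re_def .
      then obtain w where w: "m \<sqsubset> w" "\<And>z. m \<sqsubset> z \<Longrightarrow> z \<sqsubset> w \<Longrightarrow> \<not> E m z \<and> \<not> E z m"
        unfolding germ_def by blast
      obtain v where v: "m \<sqsubset> v" "v \<sqsubset> (if q \<sqsubset> w then q else w)" using dense w(1) m(2) by metis
      then have vw: "v \<sqsubset> w" "v \<sqsubset> q" by (auto split: if_splits)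
      have "lu v \<or> ld v" using that(2) const[of lu v] const[of ld v] vw v m less_trans
        unfolding I_def by blast
      then obtain z where "m \<sqsubset> z" "z \<sqsubset> v" "E v z \<or> E z v"
        using germ_gt_ex_above[OF _ v(1)] unfolding lu_def ld_def by metis
      then show False using w(2)[of z] w(2)[of v] v(1) vw(1) E_negtrans less_trans by metis
    qed
    have noteq': False if "le m" "ru m \<or> rd m"
    proof -
      have "germ gt m (\<lambda>z. \<not> E m z \<and> \<not> E z m)" using that(1) unfolding le_def .
      then obtain w where w: "w \<sqsubset> m" "\<And>z. z \<sqsubset> m \<Longrightarrow> w \<sqsubset> z \<Longrightarrow> \<not> E m z \<and> \<not> E z m"
        unfolding germ_def by blast
      obtain v where v: "v \<sqsubset> m" "(if w \<sqsubset> p then p else w) \<sqsubset> v" using dense w(1) m(1) by metis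
      then have vw: "w \<sqsubset> v" "p \<sqsubset> v" by (auto split: if_splits)
      have "ru v \<or> rd v" using that(2) const[of ru v] const[of rd v] vw v m less_trans
        unfolding I_def by blast
      then obtain z where "v \<sqsubset> z" "z \<sqsubset> m" "E v z \<or> E z v"
        using germ_ex_below[OF _ v(1)] unfolding ru_def rd_def by metis
      then show False using w(2)[of z] w(2)[of v] v(1) vw(1) E_negtrans less_trans by metis
    qed
    consider "ru m" "ld m" | "rd m" "lu m" | "re m" "le m" | "ru m" "lu m" | "rd m" "ld m"
      using types noteq noteq' by blast
    then show "(\<forall>x y. p \<sqsubset> x \<longrightarrow> x \<sqsubset> y \<longrightarrow> y \<sqsubset> q \<longrightarrow> E x y) \<or>
     (\<forall>x y. p \<sqsubset> x \<longrightarrow> x \<sqsubset> y \<longrightarrow> y \<sqsubset> q \<longrightarrow> E y x) \<or>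
     (\<forall>x y. p \<sqsubset> x \<longrightarrow> x \<sqsubset> y \<longrightarrow> y \<sqsubset> q \<longrightarrow> \<not> E x y \<and> \<not> E y x)"
    proof cases
      case 1
      have loc: "germ lt y (E y) \<and> germ gt y (\<lambda>z. E z y)" if "p \<sqsubset> y" "y \<sqsubset> q" for y
        using 1 const[of ru y] const[of ld y] that unfolding I_def ru_def ld_def by blast
      have "E x y" if "p \<sqsubset> x" "x \<sqsubset> y" "y \<sqsubset> q" for x y
        by (rule locally_increasing[of E, OF E _ loc that]) (use E_trans in blast)
      then show ?thesis by blast
    next
      case 2
      have loc: "germ lt y (\<lambda>z. E z y) \<and> germ gt y (E y)" if "p \<sqsubset> y" "y \<sqsubset> q" for y
        using 2 const[of rd y] const[of lu y] that unfolding I_def rd_def lu_def by blast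
      have "E y x" if "p \<sqsubset> x" "x \<sqsubset> y" "y \<sqsubset> q" for x y
        by (rule locally_increasing[of "\<lambda>x y. E y x", OF c.E _ loc that]) (use E_trans in blast)
      then show ?thesis by blast
    next
      case 3
      have loc: "germ lt y (\<lambda>z. \<not> E y z \<and> \<not> E z y) \<and> germ gt y (\<lambda>z. \<not> E z y \<and> \<not> E y z)"
        if "p \<sqsubset> y" "y \<sqsubset> q" for y
        using 3 const[of re y] const[of le y] that
        unfolding I_def re_def le_def conj_commute[of "\<not> E _ y"] by blast
      have "\<not> E x y \<and> \<not> E y x" if "p \<sqsubset> x" "x \<sqsubset> y" "y \<sqsubset> q" for x y
        by (rule locally_increasing[of "\<lambda>x y. \<not> E x y \<and> \<not> E y x", OF _ _ loc that])
          (intro D_intros D_app2[OF E], use E_negtrans in blast)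
      then show ?thesis by blast
    next
      case 4
      have "germ lt y (E y) \<and> germ gt y (E y)" if "p \<sqsubset> y" "y \<sqsubset> q" for y
        using 4 const[of ru y] const[of lu y] that unfolding I_def ru_def lu_def by blast
      then show ?thesis using no_interval_of_local_minima[OF pq] by blast
    next
      case 5
      have "germ lt y (\<lambda>z. E z y) \<and> germ gt y (\<lambda>z. E z y)" if "p \<sqsubset> y" "y \<sqsubset> q" for y
        using 5 const[of rd y] const[of ld y] that unfolding I_def rd_def ld_def by blast
      then show ?thesis using c.no_interval_of_local_minima[OF pq] by blast
    qed
  qed (rule F(1))
qed

end

section \<open>Behaviour at infinity and accumulation of directed families\<close>

context omin_order
begin

lemma exists_upper_bound:
  assumes "finite F"
  shows "\<exists>w. \<forall>f\<in>F. f \<sqsubset> w"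
  using assms
proof induction
  case (insert f F)
  then obtain w where w: "\<forall>f\<in>F. f \<sqsubset> w" by blast
  obtain v where "(if f \<sqsubset> w then w else f) \<sqsubset> v" using gt_ex by blast
  then have "f \<sqsubset> v" "w \<sqsubseteq> v" by (auto split: if_splits)
  then show ?case using w less_le_trans by blast
qed simp

text \<open>The counterpart of \<open>germ_dichotomy\<close> at the upper end of the order: all
  exceptional points lie below some \<open>w\<close>.\<close>

lemma eventually_constant:
  assumes "def1 A"
  shows "\<exists>w. \<forall>x y. w \<sqsubset> x \<longrightarrow> w \<sqsubset> y \<longrightarrow> A x = A y"
proof -
  obtain F where F: "finite F"
    "\<And>x y. x \<sqsubset> y \<Longrightarrow> (\<forall>f\<in>F. \<not> (x \<sqsubseteq> f \<and> f \<sqsubseteq> y)) \<Longrightarrow> A x = A y"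
    using omin[OF assms] by blast
  obtain w where w: "\<forall>f\<in>F. f \<sqsubset> w" using exists_upper_bound[OF F(1)] by blast
  have "A x = A y" if "w \<sqsubset> x" "x \<sqsubset> y" for x y
    using that w by (intro F(2)) (meson leD less_trans)+
  then show ?thesis by (metis less_linear)
qed

lemma infinite_interval: "a \<sqsubset> b \<Longrightarrow> infinite {z. a \<sqsubset> z \<and> z \<sqsubset> b}"
proof
  assume ab: "a \<sqsubset> b" and fin: "finite {z. a \<sqsubset> z \<and> z \<sqsubset> b}"
  obtain w where w: "a \<sqsubset> w" "\<And>z. a \<sqsubset> z \<Longrightarrow> z \<sqsubset> b \<Longrightarrow> \<not> z \<sqsubseteq> w"
    using exists_beyond[OF fin, of a] by blast
  obtain z where "a \<sqsubset> z" "z \<sqsubset> b" "z \<sqsubset> w" using germ_ex_below[OF germ_less[OF w(1)] ab] by blast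
  then show False using w(2)[of z] by auto
qed

text \<open>An infinite set has a point \<open>s\<close> outside the finite exceptional set, and
  \<open>A\<close> does not change on a short interval to the right of such a point.\<close>

lemma infinite_definable_contains_interval:
  assumes "def1 A" "infinite {z. A z}"
  shows "\<exists>s w. s \<sqsubset> w \<and> (\<forall>y. s \<sqsubseteq> y \<longrightarrow> y \<sqsubseteq> w \<longrightarrow> A y)"
proof -
  obtain F where F: "finite F"
    "\<And>x y. x \<sqsubset> y \<Longrightarrow> (\<forall>f\<in>F. \<not> (x \<sqsubseteq> f \<and> f \<sqsubseteq> y)) \<Longrightarrow> A x = A y"
    using omin[OF assms(1)] by blast
  obtain s where s: "A s" "s \<notin> F" using assms(2) F(1) by (metis finite_subset mem_Collect_eq subsetI)
  obtain w where w: "s \<sqsubset> w" "\<forall>f\<in>F. \<not> (s \<sqsubset> f \<and> f \<sqsubseteq> w)" using exists_beyond[OF F(1)] by blast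
  have "A y" if "s \<sqsubseteq> y" "y \<sqsubseteq> w" for y
  proof (cases "s = y")
    case False
    then have "s \<sqsubset> y" using that by simp
    moreover have "\<forall>f\<in>F. \<not> (s \<sqsubseteq> f \<and> f \<sqsubseteq> y)"
      using w(2) s(2) that(2) by (metis le_less order_trans)
    ultimately show ?thesis using F(2) s(1) by blast
  qed (use s in simp)
  then show ?thesis using w(1) by blast
qed

text \<open>This is the substitute for compactness. If the lower bounds of members have a supremum
  \<open>s0\<close>, the family accumulates there; otherwise its members are all unbounded in the
  same direction. Hypothesis \<open>lower\<close> makes the set of these bounds definable, so that
  \<open>exists_sup\<close> applies to it.\<close>

lemma directed_family_accumulates:
  assumes def1: "\<And>C. C \<in> K \<Longrightarrow> def1 C"
    and nonempty: "\<And>C. C \<in> K \<Longrightarrow> \<exists>z. C z"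
    and directed: "\<And>C C'. C \<in> K \<Longrightarrow> C' \<in> K \<Longrightarrow> \<exists>C''\<in>K. \<forall>z. C'' z \<longrightarrow> C z \<and> C' z"
    and lower: "def1 (\<lambda>s. \<exists>C\<in>K. \<forall>z. C z \<longrightarrow> \<not> z \<sqsubset> s)"
  shows "(\<exists>y. \<forall>C\<in>K. C y) \<or> (\<exists>y. \<forall>C\<in>K. germ lt y C) \<or> (\<exists>y. \<forall>C\<in>K. germ gt y C) \<or>
    (\<forall>C\<in>K. \<forall>w. \<exists>z. w \<sqsubset> z \<and> C z) \<or> (\<forall>C\<in>K. \<forall>w. \<exists>z. z \<sqsubset> w \<and> C z)"
proof -
  define S where "S s \<longleftrightarrow> (\<exists>C\<in>K. \<forall>z. C z \<longrightarrow> \<not> z \<sqsubset> s)" for s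
  consider "\<And>s. \<not> S s" | "\<And>w. \<exists>s. w \<sqsubset> s \<and> S s" | a u where "S a" "\<And>s. S s \<Longrightarrow> s \<sqsubseteq> u"
    by (meson not_less)
  then show ?thesis
  proof cases
    case 1
    then show ?thesis unfolding S_def by blast
  next
    case 2
    have "\<exists>z. w \<sqsubset> z \<and> C z" if C: "C \<in> K" for C w
    proof -
      obtain s C1 where s: "w \<sqsubset> s" "C1 \<in> K" "\<And>z. C1 z \<Longrightarrow> \<not> z \<sqsubset> s"
        using 2[of w] unfolding S_def by blast
      obtain C2 where "C2 \<in> K" "\<forall>z. C2 z \<longrightarrow> C z \<and> C1 z" using directed[OF C s(2)] by blast
      moreover then obtain z where "C2 z" using nonempty by blast
      ultimately have "C z" "\<not> z \<sqsubset> s" using s(3) by blast+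
      then show ?thesis using s(1) less_le_trans not_less by blast
    qed
    then show ?thesis by blast
  next
    case 3
    have "def1 S" unfolding S_def by (rule lower)
    then obtain s0 where s0: "\<And>z. S z \<Longrightarrow> z \<sqsubseteq> s0" "\<And>t. t \<sqsubset> s0 \<Longrightarrow> \<exists>z. S z \<and> t \<sqsubset> z"
      using exists_sup[of S a u] 3 by blast
    \<comment> \<open>Refine \<open>C\<close> by a member bounded below by some \<open>s'\<close>
      beyond \<open>s\<close>; since \<open>t\<close> bounds no member from below, the refinement
      has a point between \<open>s\<close> and \<open>t\<close>.\<close>
    have meets: "\<exists>z. C z \<and> s \<sqsubset> z \<and> z \<sqsubset> t" if C: "C \<in> K" and st: "s \<sqsubset> s0" "s0 \<sqsubset> t" for C s t
    proof -
      obtain s' C1 where s': "s \<sqsubset> s'" "C1 \<in> K" "\<And>z. C1 z \<Longrightarrow> \<not> z \<sqsubset> s'"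
        using s0(2)[OF st(1)] unfolding S_def by blast
      obtain C2 where C2: "C2 \<in> K" "\<forall>z. C2 z \<longrightarrow> C z \<and> C1 z" using directed[OF C s'(2)] by blast
      have "\<not> S t" using s0(1)[of t] st(2) by (meson leD)
      then obtain z where "C2 z" "z \<sqsubset> t" using C2(1) unfolding S_def by blast
      then show ?thesis using C2(2) s' less_le_trans not_less by blast
    qed
    \<comment> \<open>If each alternative failed for some member, a common refinement would fail all
      three and hence miss a whole interval around \<open>s0\<close>, against
      \<open>meets\<close>.\<close>
    have "(\<forall>C\<in>K. C s0) \<or> (\<forall>C\<in>K. germ lt s0 C) \<or> (\<forall>C\<in>K. germ gt s0 C)"
    proof (rule ccontr)
      assume "\<not> ?thesis"
      then obtain C1 C2 C3 where C123: "C1 \<in> K" "C2 \<in> K" "C3 \<in> K"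
        "\<not> C1 s0" "\<not> germ lt s0 C2" "\<not> germ gt s0 C3" by blast
      obtain C4 where C4: "C4 \<in> K" "\<forall>z. C4 z \<longrightarrow> C1 z \<and> C2 z" using directed C123 by metis
      obtain C where C: "C \<in> K" "\<forall>z. C z \<longrightarrow> C4 z \<and> C3 z" using directed[OF C4(1) C123(3)] by blast
      have "\<not> C s0" "\<not> germ lt s0 C" "\<not> germ gt s0 C"
        using C123 C4 C germ_mono[of s0 C C2] germ_gt_mono[of s0 C C3] by blast+
      then obtain t s where "s0 \<sqsubset> t" "\<And>z. s0 \<sqsubset> z \<Longrightarrow> z \<sqsubset> t \<Longrightarrow> \<not> C z"
        "s \<sqsubset> s0" "\<And>z. z \<sqsubset> s0 \<Longrightarrow> s \<sqsubset> z \<Longrightarrow> \<not> C z"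
        using germ_dichotomy[OF def1[OF C(1)], of s0] germ_gt_dichotomy[OF def1[OF C(1)], of s0]
        unfolding germ_def by blast
      then show False using meets[OF C(1), of s t] \<open>\<not> C s0\<close> less_linear by metis
    qed
    then show ?thesis by blast
  qed
qed

end

section \<open>Definable Hausdorff topologies\<close>

text \<open>\<open>B u\<close> is the basic open set with index \<open>u\<close>, a list of length
  \<open>m\<close> in \<open>U\<close>; in the definability assumption on \<open>B\<close>, the
  variables below \<open>m\<close> carry the index and variable \<open>m\<close> the point. A point
  belongs to the space if it lies in some basic set, which is what the premises \<open>B u x\<close>
  and \<open>B v y\<close> of \<open>Hausdorff\<close> express.\<close>

locale omin_space = omin_order +
  fixes m :: nat and U :: "'a list \<Rightarrow> bool" and B :: "'a list \<Rightarrow> 'a \<Rightarrow> bool"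
  assumes U: "D (\<lambda>e. U (map e [0..<m]))"
    and B: "D (\<lambda>e. B (map e [0..<m]) (e m))"
    and directed: "length u = m \<Longrightarrow> U u \<Longrightarrow> B u x \<Longrightarrow> length v = m \<Longrightarrow> U v \<Longrightarrow> B v x \<Longrightarrow>
      \<exists>w. length w = m \<and> U w \<and> B w x \<and> (\<forall>z. B w z \<longrightarrow> B u z \<and> B v z)"
    and Hausdorff: "length u = m \<Longrightarrow> U u \<Longrightarrow> B u x \<Longrightarrow> length v = m \<Longrightarrow> U v \<Longrightarrow> B v y \<Longrightarrow> x \<noteq> y \<Longrightarrow>
      \<exists>u v. length u = m \<and> U u \<and> B u x \<and> length v = m \<and> U v \<and> B v y \<and> (\<forall>z. \<not> (B u z \<and> B v z))"
begin

lemma dual_space: "omin_space (\<lambda>x y. y \<sqsubseteq> x) (\<lambda>x y. y \<sqsubset> x) D m U B"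
proof -
  interpret d: omin_order "\<lambda>x y. y \<sqsubseteq> x" "\<lambda>x y. y \<sqsubset> x" D by (rule dual)
  show ?thesis by unfold_locales (fact U B directed Hausdorff)+
qed

definition nbhd :: "'a \<Rightarrow> ('a \<Rightarrow> bool) \<Rightarrow> bool" where
  "nbhd x A \<longleftrightarrow> (\<exists>u. length u = m \<and> U u \<and> A = B u \<and> B u x)"

definition inspace :: "'a \<Rightarrow> bool" where
  "inspace x \<longleftrightarrow> (\<exists>A. nbhd x A)"

text \<open>For \<open>r = lt\<close> this says that \<open>z\<close> converges to \<open>x\<close>
  in the topology as \<open>z\<close> tends to \<open>y\<close> from the right. The conjunct
  \<open>inspace x\<close> excludes points without basic neighbourhoods, for which the rest would
  hold vacuously.\<close>

definition adherent :: "('a \<Rightarrow> 'a \<Rightarrow> bool) \<Rightarrow> 'a \<Rightarrow> 'a \<Rightarrow> bool" where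
  "adherent r x y \<longleftrightarrow> inspace x \<and> (\<forall>A. nbhd x A \<longrightarrow> germ r y A)"

section \<open>Definability and uniqueness of adherence\<close>

lemma D_U:
  assumes "\<And>i. is_variable_or_constant (s i)"
  shows "D (\<lambda>e. U (map (\<lambda>i. s i e) [0..<m]))"
  using D_subst[OF U assms] by simp

lemma D_B:
  assumes "\<And>i. is_variable_or_constant (s i)" "is_variable_or_constant t"
  shows "D (\<lambda>e. B (map (\<lambda>i. s i e) [0..<m]) (t e))"
proof -
  have "is_variable_or_constant (if i < m then s i else t)" for i using assms by simp
  from D_subst[OF B, of "\<lambda>i. if i < m then s i else t", OF this]
  have "D (\<lambda>e. B (map (\<lambda>i. (if i < m then s i else t) e) [0..<m]) (t e))" by simp
  moreover have "map (\<lambda>i. (if i < m then s i else t) e) [0..<m] = map (\<lambda>i. s i e) [0..<m]" for e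
    by simp
  ultimately show ?thesis by simp
qed

lemma nbhd_self: "nbhd x A \<Longrightarrow> A x"
  unfolding nbhd_def by blast

lemma nbhd_other: "nbhd x A \<Longrightarrow> A y \<Longrightarrow> nbhd y A"
  unfolding nbhd_def by blast

lemma def1_nbhd:
  assumes "nbhd x A"
  shows "def1 A"
proof -
  obtain u where u: "length u = m" "A = B u" using assms unfolding nbhd_def by blast
  have "D (\<lambda>e. B (map (\<lambda>i. u ! i) [0..<m]) (e 0))" by (intro D_B D_intros)
  moreover have "map (\<lambda>i. u ! i) [0..<m] = u" using u(1) by (auto intro: nth_equalityI)
  ultimately show ?thesis using u(2) by simp
qed

lemma nbhd_directed:
  "nbhd x A \<Longrightarrow> nbhd x A' \<Longrightarrow> \<exists>A''. nbhd x A'' \<and> (\<forall>z. A'' z \<longrightarrow> A z \<and> A' z)"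
  unfolding nbhd_def using directed by metis

lemma nbhd_separate:
  "inspace x \<Longrightarrow> inspace y \<Longrightarrow> x \<noteq> y \<Longrightarrow> \<exists>A A'. nbhd x A \<and> nbhd y A' \<and> (\<forall>z. \<not> (A z \<and> A' z))"
  unfolding nbhd_def inspace_def using Hausdorff by metis

lemma def1_inspace: "def1 inspace"
proof -
  have "D (\<lambda>e. \<exists>u. length u = m \<and> U u \<and> B u (e 0))"
    by (rule D_ex_list) (intro D_intros D_U D_B)
  then show ?thesis unfolding inspace_def nbhd_def by simp
qed

text \<open>Neighbourhoods are quantified through their indices; the universal quantifier becomes a
  negated existential one so that \<open>D_ex_list\<close> applies.\<close>

lemma def2_adherent: "def2 (adherent lt)"
proof -
  have "D (\<lambda>e. \<exists>u. length u = m \<and> U u \<and> B u (e 0) \<and> \<not> germ lt (e 1) (B u))"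
    unfolding germ_def by (rule D_ex_list) (intro D_intros D_U D_B)
  then have "D (\<lambda>e. inspace (e 0) \<and> \<not> (\<exists>u. length u = m \<and> U u \<and> B u (e 0) \<and> \<not> germ lt (e 1) (B u)))"
    by (intro D_intros D_app1[OF def1_inspace])
  moreover have "adherent lt x y \<longleftrightarrow>
      inspace x \<and> \<not> (\<exists>u. length u = m \<and> U u \<and> B u x \<and> \<not> germ lt y (B u))" for x y
    unfolding adherent_def nbhd_def by blast
  ultimately show ?thesis by simp
qed

text \<open>One-sided limits in a Hausdorff space are unique.\<close>

lemma adherent_unique:
  assumes "adherent lt x y" "adherent lt x' y"
  shows "x = x'"
proof (rule ccontr)
  assume "x \<noteq> x'"
  then obtain A A' where "nbhd x A" "nbhd x' A'" "\<forall>z. \<not> (A z \<and> A' z)"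
    using nbhd_separate assms unfolding adherent_def by blast
  then show False using assms germ_ex[OF germ_conj, of y A A'] unfolding adherent_def by blast
qed

text \<open>The condition on \<open>F\<close> says that no point of \<open>F\<close> equals or
  separates \<open>x\<close> and \<open>y\<close>. The cut points are those of the monotonicity
  theorem for \<open>g\<close> and those where the direction in which \<open>g\<close> moves its
  argument may change.\<close>

lemma adherent_cut:
  "\<exists>F. finite F \<and> (\<forall>x y. (\<forall>f\<in>F. f \<sqsubset> x \<and> f \<sqsubset> y \<or> x \<sqsubset> f \<and> y \<sqsubset> f) \<longrightarrow> adherent lt x y \<longrightarrow> x = y)"
proof -
  \<comment> \<open>The default \<open>g y = y\<close> makes \<open>g\<close> total; the points with
    \<open>g y \<noteq> y\<close> form the domain of the partial function.\<close>
  define g where "g y = (if \<exists>x. x \<noteq> y \<and> adherent lt x y then THE x. x \<noteq> y \<and> adherent lt x y else y)" for y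
  have g_eq: "g y = x" if "x \<noteq> y" "adherent lt x y" for x y
    unfolding g_def using that adherent_unique by (auto intro!: the_equality)
  have g_adh: "adherent lt (g y) y" if gy: "g y \<noteq> y" for y
  proof -
    obtain x where "x \<noteq> y" "adherent lt x y" using gy unfolding g_def by (meson if_not_P)
    then show ?thesis using g_eq by simp
  qed
  have "g y = x \<longleftrightarrow> x \<noteq> y \<and> adherent lt x y \<or> x = y \<and> (\<forall>z. z \<noteq> y \<longrightarrow> \<not> adherent lt z y)" for x y
    using g_eq g_adh by metis
  moreover have "def2 (\<lambda>y x. x \<noteq> y \<and> adherent lt x y \<or> x = y \<and> (\<forall>z. z \<noteq> y \<longrightarrow> \<not> adherent lt z y))"
    by (intro D_intros D_app2[OF def2_adherent])
  ultimately have G: "def2 (\<lambda>y x. g y = x)" by simp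
  define E where "E x y \<longleftrightarrow> g x \<sqsubset> g y" for x y
  \<comment> \<open>Definability is known for the graph of \<open>g\<close>, so its values enter
    through quantifiers.\<close>
  have "def2 (\<lambda>x y. \<exists>a b. g x = a \<and> g y = b \<and> a \<sqsubset> b)" by (intro D_intros D_app2[OF G])
  then have defE: "def2 E" unfolding E_def by simp
  interpret E: omin_weak_order leq lt D E
    by unfold_locales (fact defE, auto simp: E_def)
  define pos where "pos y \<longleftrightarrow> y \<sqsubset> g y" for y
  define neg where "neg y \<longleftrightarrow> g y \<sqsubset> y" for y
  have "def1 (\<lambda>y. \<exists>a. g y = a \<and> y \<sqsubset> a)" "def1 (\<lambda>y. \<exists>a. g y = a \<and> a \<sqsubset> y)"
    by (intro D_intros D_app2[OF G])+
  then have def_pos: "def1 pos" "def1 neg" unfolding pos_def neg_def by simp_all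
  obtain F1 where F1: "finite F1"
    "\<And>p q. p \<sqsubset> q \<Longrightarrow> \<forall>f\<in>F1. \<not> (p \<sqsubset> f \<and> f \<sqsubset> q) \<Longrightarrow>
     (\<forall>x y. p \<sqsubset> x \<longrightarrow> x \<sqsubset> y \<longrightarrow> y \<sqsubset> q \<longrightarrow> E x y) \<or>
     (\<forall>x y. p \<sqsubset> x \<longrightarrow> x \<sqsubset> y \<longrightarrow> y \<sqsubset> q \<longrightarrow> E y x) \<or>
     (\<forall>x y. p \<sqsubset> x \<longrightarrow> x \<sqsubset> y \<longrightarrow> y \<sqsubset> q \<longrightarrow> \<not> E x y \<and> \<not> E y x)"
    using E.monotonicity by blast
  have "\<forall>A\<in>{pos, neg}. def1 A" using def_pos by simp
  then obtain F2 where F2: "finite F2"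
    "\<And>x y. x \<sqsubset> y \<Longrightarrow> \<forall>f\<in>F2. \<not> (x \<sqsubseteq> f \<and> f \<sqsubseteq> y) \<Longrightarrow> pos x = pos y \<and> neg x = neg y"
    using omin_pieces[of "{pos, neg}"] by fastforce
  show ?thesis
  proof (intro exI[of _ "F1 \<union> F2"] conjI allI impI)
    show "finite (F1 \<union> F2)" using F1(1) F2(1) by blast
    fix x0 y0 assume avoid: "\<forall>f\<in>F1 \<union> F2. f \<sqsubset> x0 \<and> f \<sqsubset> y0 \<or> x0 \<sqsubset> f \<and> y0 \<sqsubset> f"
      and adh: "adherent lt x0 y0"
    show "x0 = y0"
    proof (rule ccontr)
      assume neq: "x0 \<noteq> y0"
      have gy0: "g y0 = x0" using g_eq neq adh by blast
      define lo where "lo = (if x0 \<sqsubset> y0 then x0 else y0)"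
      define hi where "hi = (if x0 \<sqsubset> y0 then y0 else x0)"
      have lohi: "lo \<sqsubseteq> x0" "lo \<sqsubseteq> y0" "x0 \<sqsubseteq> hi" "y0 \<sqsubseteq> hi" "lo = x0 \<or> lo = y0" "hi = x0 \<or> hi = y0"
        unfolding lo_def hi_def by auto
      have fin: "finite (F1 \<union> F2)" using F1(1) F2(1) by blast
      \<comment> \<open>Monotonicity concerns open intervals, so the closed hull of
        \<open>x0\<close> and \<open>y0\<close> is enlarged to an open one from \<open>p\<close> to
        \<open>q\<close> that is still free of cut points.\<close>
      obtain p where p: "p \<sqsubset> lo" "\<forall>f\<in>F1 \<union> F2. \<not> (f \<sqsubset> lo \<and> p \<sqsubseteq> f)" using exists_before[OF fin] by blast
      obtain q where q: "hi \<sqsubset> q" "\<forall>f\<in>F1 \<union> F2. \<not> (hi \<sqsubset> f \<and> f \<sqsubseteq> q)" using exists_beyond[OF fin] by blast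
      have free: "\<not> (p \<sqsubset> f \<and> f \<sqsubset> q)" if "f \<in> F1 \<union> F2" for f
        using p(2) q(2) avoid that lohi(5,6) by (metis less_imp_le)
      have px: "p \<sqsubset> x0" "x0 \<sqsubset> q" "p \<sqsubset> y0" "y0 \<sqsubset> q"
        using p(1) q(1) lohi less_le_trans le_less_trans by blast+
      have sign_lt: "pos x = pos y \<and> neg x = neg y" if "p \<sqsubset> x" "x \<sqsubset> y" "y \<sqsubset> q" for x y
        using that free less_le_trans le_less_trans by (intro F2(2)) blast+
      have sign: "pos x = pos y0 \<and> neg x = neg y0" if "p \<sqsubset> x" "x \<sqsubset> q" for x
        using sign_lt[of x y0] sign_lt[of y0 x] that px less_linear[of x y0] by metis
      have pn: "pos y0 \<or> neg y0" unfolding pos_def neg_def using gy0 neq less_linear by metis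
      have moves: "g x \<noteq> x" if "p \<sqsubset> x" "x \<sqsubset> q" for x
        using sign[OF that] pn unfolding pos_def neg_def by (metis less_irrefl)
      have "p \<sqsubset> q" using px less_trans by blast
      then consider (inc) "\<And>x y. p \<sqsubset> x \<Longrightarrow> x \<sqsubset> y \<Longrightarrow> y \<sqsubset> q \<Longrightarrow> g x \<sqsubset> g y"
        | (dec) "\<And>x y. p \<sqsubset> x \<Longrightarrow> x \<sqsubset> y \<Longrightarrow> y \<sqsubset> q \<Longrightarrow> g y \<sqsubset> g x"
        | (const) "\<And>x y. p \<sqsubset> x \<Longrightarrow> x \<sqsubset> y \<Longrightarrow> y \<sqsubset> q \<Longrightarrow> g x = g y"
        using F1(2)[of p q] free unfolding E_def by (metis UnI1 less_linear)
      then show False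
      proof cases
        \<comment> \<open>Compare \<open>y0\<close> with its image \<open>x0\<close>, which
          \<open>g\<close> moves in the same direction.\<close>
        case dec
        show False
        proof (cases "pos y0")
          case True
          then have "y0 \<sqsubset> x0" "x0 \<sqsubset> g x0" using sign px gy0 unfolding pos_def by metis+
          then show False using dec[of y0 x0] px gy0 less_asym by metis
        next
          case False
          then have "x0 \<sqsubset> y0" "g x0 \<sqsubset> x0" using pn sign px gy0 unfolding neg_def by metis+
          then show False using dec[of x0 y0] px gy0 less_asym by metis
        qed
      next
        case const
        then have "g x0 = g y0" using px neq less_linear[of x0 y0] by metis
        then show False using moves[of x0] px gy0 by simp
      next
        case inc
        \<comment> \<open>On the side of \<open>y0\<close> away from \<open>x0\<close>, the value at
          \<open>z\<close> is caught between \<open>z\<close> and \<open>x0\<close> and so stays in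
          the piece.\<close>
        obtain a b where ab: "a \<sqsubset> b" "p \<sqsubseteq> a" "b \<sqsubseteq> q"
          and g_in: "\<And>z. a \<sqsubset> z \<Longrightarrow> z \<sqsubset> b \<Longrightarrow> p \<sqsubset> g z \<and> g z \<sqsubset> q"
        proof (cases "pos y0")
          case True
          show thesis
          proof (rule that[of p y0])
            fix z assume z: "p \<sqsubset> z" "z \<sqsubset> y0"
            then have "z \<sqsubset> g z" using sign[of z] px True less_trans unfolding pos_def by blast
            moreover have "g z \<sqsubset> x0" using inc[of z y0] z px gy0 by simp
            ultimately show "p \<sqsubset> g z \<and> g z \<sqsubset> q" using z px less_trans by blast
          qed (use px in auto)
        next
          case False
          show thesis
          proof (rule that[of y0 q])
            fix z assume z: "y0 \<sqsubset> z" "z \<sqsubset> q"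
            then have "g z \<sqsubset> z" using pn sign[of z] px False less_trans unfolding neg_def by blast
            moreover have "x0 \<sqsubset> g z" using inc[of y0 z] z px gy0 by simp
            ultimately show "p \<sqsubset> g z \<and> g z \<sqsubset> q" using z px less_trans by blast
          qed (use px in auto)
        qed
        have in_pq: "p \<sqsubset> z" "z \<sqsubset> q" if "a \<sqsubset> z" "z \<sqsubset> b" for z
          using that ab le_less_trans less_le_trans by blast+
        have inc_ab: "g x \<sqsubset> g y" if "a \<sqsubset> x" "x \<sqsubset> y" "y \<sqsubset> b" for x y
          using inc that ab le_less_trans less_le_trans by blast
        have inc_rev: "x \<sqsubset> y" if "a \<sqsubset> x" "y \<sqsubset> b" "x \<sqsubset> b" "a \<sqsubset> y" "g x \<sqsubset> g y" for x y
          using inc_ab[of y x] that less_linear[of x y] less_asym by metis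
        define Im where "Im y \<longleftrightarrow> (\<exists>z. a \<sqsubset> z \<and> z \<sqsubset> b \<and> g z = y)" for y
        have "def1 Im" unfolding Im_def by (intro D_intros D_app2[OF G])
        moreover have "infinite {y. Im y}"
        proof -
          have "inj_on g {z. a \<sqsubset> z \<and> z \<sqsubset> b}"
            using inc_ab by (auto simp: inj_on_def) (metis less_irrefl less_linear)
          then have "infinite (g ` {z. a \<sqsubset> z \<and> z \<sqsubset> b})"
            using infinite_interval[OF ab(1)] finite_imageD by blast
          moreover have "g ` {z. a \<sqsubset> z \<and> z \<sqsubset> b} = {y. Im y}" unfolding Im_def by auto
          ultimately show ?thesis by simp
        qed
        \<comment> \<open>The image of an injective function on an interval is infinite, hence
          contains an interval of values starting at \<open>s\<close>; so the points just to the
          right of \<open>s\<close> are values of \<open>g\<close> too.\<close>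
        ultimately obtain s w where s: "s \<sqsubset> w" "\<And>y. s \<sqsubseteq> y \<Longrightarrow> y \<sqsubseteq> w \<Longrightarrow> Im y"
          using infinite_definable_contains_interval by blast
        have "Im s" using s(1) s(2)[of s] by simp
        then obtain z0 where z0: "a \<sqsubset> z0" "z0 \<sqsubset> b" "g z0 = s" unfolding Im_def by blast
        have gs: "g s \<noteq> s" using moves g_in[of z0] z0 by metis
        have adh_s: "adherent lt (g s) s" using g_adh gs by blast
        have adh_z0: "adherent lt s z0" using g_adh[of z0] moves[of z0] in_pq z0 by metis
        have "germ lt z0 A" if A: "nbhd (g s) A" for A
        proof (rule ccontr)
          assume "\<not> germ lt z0 A"
          then have "germ lt z0 (\<lambda>z. \<not> A z)" using germ_dichotomy[OF def1_nbhd[OF A]] by blast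
          then obtain c where c: "z0 \<sqsubset> c" "\<And>z. z0 \<sqsubset> z \<Longrightarrow> z \<sqsubset> c \<Longrightarrow> \<not> A z" unfolding germ_def by blast
          obtain w' where w': "z0 \<sqsubset> w'" "w' \<sqsubset> b" "w' \<sqsubset> c"
            using germ_ex_below[OF germ_less[OF c(1)] z0(2)] by blast
          have "s \<sqsubset> g w'" using inc_ab[of z0 w'] z0 w' by simp
          have "germ lt s A" using adh_s A unfolding adherent_def by blast
          \<comment> \<open>Taking \<open>y'\<close> below \<open>g w'\<close> places its preimage
            \<open>z'\<close> between \<open>z0\<close> and \<open>w'\<close>, where
            \<open>A\<close> was assumed to be absent.\<close>
          then obtain y' where y': "s \<sqsubset> y'" "y' \<sqsubset> w" "A y'" "y' \<sqsubset> g w'"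
            using germ_ex_below[OF germ_conj[OF _ germ_less[OF \<open>s \<sqsubset> g w'\<close>]] s(1)] by metis
          then obtain z' where z': "a \<sqsubset> z'" "z' \<sqsubset> b" "g z' = y'"
            using s(2)[of y'] unfolding Im_def by (meson less_imp_le)
          have "z0 \<sqsubset> z'" "z' \<sqsubset> w'" using inc_rev z0 z' w' y' less_trans by metis+
          have "adherent lt y' z'" using g_adh[of z'] moves[of z'] in_pq z' by metis
          then have "germ lt z' A" using nbhd_other[OF A y'(3)] unfolding adherent_def by blast
          moreover have "z' \<sqsubset> c" using \<open>z' \<sqsubset> w'\<close> w'(3) less_trans by blast
          ultimately obtain v where "z' \<sqsubset> v" "v \<sqsubset> c" "A v" using germ_ex_below by blast
          then show False using c(2)[of v] \<open>z0 \<sqsubset> z'\<close> less_trans by blast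
        qed
        then have "adherent lt (g s) z0" using adh_s unfolding adherent_def by blast
        then show False using adherent_unique adh_z0 gs by metis
      qed
    qed
  qed
qed

lemmas left_adherent_cut = omin_space.adherent_cut[OF dual_space]
lemmas def2_left_adherent = omin_space.def2_adherent[OF dual_space]

text \<open>These points act as points adherent to plus infinity. A neighbourhood that is unbounded
  above is eventually constant, hence contains a final ray, so two such points could not be
  separated.\<close>

lemma finite_unbounded:
  "finite {x. inspace x \<and> (\<forall>A. nbhd x A \<longrightarrow> (\<forall>w. \<exists>z. w \<sqsubset> z \<and> A z))}" (is "finite {x. ?P x}")
proof -
  have "x = y" if "?P x" "?P y" for x y
  proof (rule ccontr)
    assume "x \<noteq> y"
    then obtain A A' where A: "nbhd x A" "nbhd y A'" "\<forall>z. \<not> (A z \<and> A' z)"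
      using nbhd_separate \<open>?P x\<close> \<open>?P y\<close> by blast
    obtain w where w: "\<And>u v. w \<sqsubset> u \<Longrightarrow> w \<sqsubset> v \<Longrightarrow> A u = A v"
      using eventually_constant[OF def1_nbhd[OF A(1)]] by blast
    obtain u where "w \<sqsubset> u" "A u" using \<open>?P x\<close> A(1) by blast
    moreover obtain v where "w \<sqsubset> v" "A' v" using \<open>?P y\<close> A(2) by blast
    ultimately show False using w A(3) by blast
  qed
  then have "{x. ?P x} \<subseteq> {THE x. ?P x}" by (auto intro!: the_equality[symmetric])
  then show ?thesis by (rule finite_subset) simp
qed

lemmas finite_unbounded_below = omin_space.finite_unbounded[OF dual_space]

text \<open>This permits cutting also at the points adherent to a cut point, which excludes
  accumulation at the ends of a piece.\<close>

lemma finite_adherent_to: "finite {x. adherent lt x f}"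
proof -
  have "{x. adherent lt x f} \<subseteq> {THE x. adherent lt x f}"
    using adherent_unique by (auto intro!: the_equality[symmetric])
  then show ?thesis by (rule finite_subset) simp
qed

lemmas finite_left_adherent_to = omin_space.finite_adherent_to[OF dual_space]

text \<open>The point \<open>s\<close> may be the left end of \<open>Y\<close> rather than a member.
  As \<open>Y\<close> is convex and contains an interval starting at \<open>s\<close>, no cut point
  lies strictly between \<open>s\<close> and \<open>x\<close>, and \<open>cut\<close>
  applies.\<close>

lemma adherent_in_piece:
  assumes cut: "\<And>x y. (\<forall>f\<in>F. f \<sqsubset> x \<and> f \<sqsubset> y \<or> x \<sqsubset> f \<and> y \<sqsubset> f) \<Longrightarrow> adherent lt x y \<Longrightarrow> x = y"
    and convex: "\<And>x y z. Y x \<Longrightarrow> Y z \<Longrightarrow> x \<sqsubset> y \<Longrightarrow> y \<sqsubset> z \<Longrightarrow> Y y"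
    and avoid: "\<And>f. f \<in> F \<Longrightarrow> \<not> Y f"
    and "s \<notin> F" "Y x" "germ lt s Y" "adherent lt x s"
  shows "s = x"
proof (rule cut[symmetric])
  show "\<forall>f\<in>F. f \<sqsubset> x \<and> f \<sqsubset> s \<or> x \<sqsubset> f \<and> s \<sqsubset> f"
  proof
    fix f assume f: "f \<in> F"
    have "f \<noteq> x" "f \<noteq> s" using f avoid assms(4,5) by blast+
    have "\<not> (s \<sqsubset> f \<and> f \<sqsubset> x)"
    proof
      assume "s \<sqsubset> f \<and> f \<sqsubset> x"
      moreover then obtain z where "Y z" "z \<sqsubset> f" using germ_ex_below[OF assms(6)] by blast
      ultimately show False using convex avoid f assms(5) by blast
    qed
    moreover have "\<not> (x \<sqsubset> f \<and> f \<sqsubset> s)"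
    proof
      assume "x \<sqsubset> f \<and> f \<sqsubset> s"
      moreover obtain z where "Y z" "s \<sqsubset> z" using germ_ex[OF assms(6)] by blast
      ultimately show False using convex[of x z f] avoid f assms(5) less_trans by blast
    qed
    ultimately show "f \<sqsubset> x \<and> f \<sqsubset> s \<or> x \<sqsubset> f \<and> s \<sqsubset> f"
      using \<open>f \<noteq> x\<close> \<open>f \<noteq> s\<close> less_linear by metis
  qed
qed fact

lemmas left_adherent_in_piece = omin_space.adherent_in_piece[OF dual_space]

text \<open>The cut points are the changes of type (\<open>F0\<close>), the cuts for adherence from
  either side (\<open>FR\<close>, \<open>FL\<close>), the points adherent to such a cut
  (\<open>F2\<close>) and those adherent to an end of the order (\<open>F3\<close>). If no
  neighbourhood \<open>A\<close> of \<open>x\<close> satisfied the last claim, the parts of these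
  \<open>A\<close> inside \<open>Y\<close> and outside \<open>N\<close> would form a directed family
  of nonempty sets, and every way in which it can accumulate is excluded.\<close>

theorem homogeneous_pieces:
  "\<exists>F. finite F \<and> (\<forall>Y. def1 Y \<longrightarrow> (\<forall>f\<in>F. \<not> Y f) \<longrightarrow>
     (\<forall>x y z. Y x \<longrightarrow> Y z \<longrightarrow> x \<sqsubset> y \<longrightarrow> y \<sqsubset> z \<longrightarrow> Y y) \<longrightarrow>
     (\<exists>i r l. \<forall>x. Y x \<longrightarrow> (inspace x \<longleftrightarrow> i) \<and> (adherent lt x x \<longleftrightarrow> r) \<and> (adherent gt x x \<longleftrightarrow> l)) \<and>
     (\<forall>x N. Y x \<longrightarrow> inspace x \<longrightarrow> def1 N \<longrightarrow> N x \<longrightarrow>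
        (adherent lt x x \<longrightarrow> germ lt x N) \<longrightarrow> (adherent gt x x \<longrightarrow> germ gt x N) \<longrightarrow>
        (\<exists>A. nbhd x A \<and> (\<forall>z. A z \<longrightarrow> Y z \<longrightarrow> N z))))"
proof -
  have "def1 (\<lambda>x. adherent lt x x)" "def1 (\<lambda>x. adherent gt x x)"
    by (intro D_app2[OF def2_adherent] D_app2[OF def2_left_adherent] D_intros)+
  then have "\<forall>A\<in>{inspace, \<lambda>x. adherent lt x x, \<lambda>x. adherent gt x x}. def1 A"
    using def1_inspace by simp
  then obtain F0 where F0: "finite F0"
    "\<And>x y. x \<sqsubset> y \<Longrightarrow> \<forall>f\<in>F0. \<not> (x \<sqsubseteq> f \<and> f \<sqsubseteq> y) \<Longrightarrow>
      inspace x = inspace y \<and> adherent lt x x = adherent lt y y \<and> adherent gt x x = adherent gt y y"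
    using omin_pieces[of "{inspace, \<lambda>x. adherent lt x x, \<lambda>x. adherent gt x x}"] by fastforce
  obtain FR where FR: "finite FR"
    "\<And>x y. \<forall>f\<in>FR. f \<sqsubset> x \<and> f \<sqsubset> y \<or> x \<sqsubset> f \<and> y \<sqsubset> f \<Longrightarrow> adherent lt x y \<Longrightarrow> x = y"
    using adherent_cut by blast
  obtain FL where FL: "finite FL"
    "\<And>x y. \<forall>f\<in>FL. x \<sqsubset> f \<and> y \<sqsubset> f \<or> f \<sqsubset> x \<and> f \<sqsubset> y \<Longrightarrow> adherent gt x y \<Longrightarrow> x = y"
    using left_adherent_cut by blast
  define F2 where "F2 = (\<Union>f\<in>FR. {x. adherent lt x f}) \<union> (\<Union>f\<in>FL. {x. adherent gt x f})"
  define F3 where "F3 = {x. inspace x \<and> (\<forall>A. nbhd x A \<longrightarrow> (\<forall>w. \<exists>z. w \<sqsubset> z \<and> A z))} \<union>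
    {x. inspace x \<and> (\<forall>A. nbhd x A \<longrightarrow> (\<forall>w. \<exists>z. z \<sqsubset> w \<and> A z))}"
  define F where "F = F0 \<union> FR \<union> FL \<union> F2 \<union> F3"
  have "finite F" unfolding F_def F2_def F3_def
    using F0(1) FR(1) FL(1) finite_adherent_to finite_left_adherent_to
      finite_unbounded finite_unbounded_below by blast
  show ?thesis
  proof (intro exI[of _ F] conjI allI impI)
    fix Y assume Y: "def1 Y" "\<forall>f\<in>F. \<not> Y f"
      and convex: "\<forall>x y z. Y x \<longrightarrow> Y z \<longrightarrow> x \<sqsubset> y \<longrightarrow> y \<sqsubset> z \<longrightarrow> Y y"
    have "inspace x = inspace y \<and> adherent lt x x = adherent lt y y \<and> adherent gt x x = adherent gt y y"
      if "Y x" "Y y" "x \<sqsubset> y" for x y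
    proof (rule F0(2))
      show "\<forall>f\<in>F0. \<not> (x \<sqsubseteq> f \<and> f \<sqsubseteq> y)"
        using Y(2) convex that unfolding F_def by (metis UnI1 le_less)
    qed fact
    then have eq: "inspace x = inspace y \<and> adherent lt x x = adherent lt y y \<and> adherent gt x x = adherent gt y y"
      if "Y x" "Y y" for x y
      using that less_linear[of x y] by metis
    show "\<exists>i r l. \<forall>x. Y x \<longrightarrow> (inspace x \<longleftrightarrow> i) \<and> (adherent lt x x \<longleftrightarrow> r) \<and> (adherent gt x x \<longleftrightarrow> l)"
      using eq by (cases "\<exists>y. Y y") blast+
    fix x N assume x: "Y x" "inspace x" and N: "def1 N" "N x" "adherent lt x x \<longrightarrow> germ lt x N"
      "adherent gt x x \<longrightarrow> germ gt x N"
    show "\<exists>A. nbhd x A \<and> (\<forall>z. A z \<longrightarrow> Y z \<longrightarrow> N z)"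
    proof (rule ccontr)
      assume contra: "\<not> ?thesis"
      define K where "K = {\<lambda>z. A z \<and> Y z \<and> \<not> N z |A. nbhd x A}"
      have K: "(\<lambda>z. A z \<and> Y z \<and> \<not> N z) \<in> K" if "nbhd x A" for A using that unfolding K_def by blast
      have "(\<exists>y. \<forall>C\<in>K. C y) \<or> (\<exists>y. \<forall>C\<in>K. germ lt y C) \<or> (\<exists>y. \<forall>C\<in>K. germ gt y C) \<or>
        (\<forall>C\<in>K. \<forall>w. \<exists>z. w \<sqsubset> z \<and> C z) \<or> (\<forall>C\<in>K. \<forall>w. \<exists>z. z \<sqsubset> w \<and> C z)"
      proof (rule directed_family_accumulates)
        show "def1 C" if C: "C \<in> K" for C
        proof -
          obtain A where A: "nbhd x A" "C = (\<lambda>z. A z \<and> Y z \<and> \<not> N z)" using C unfolding K_def by blast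
          show ?thesis unfolding A(2)
            by (intro D_intros D_app1[OF def1_nbhd[OF A(1)]] D_app1[OF Y(1)] D_app1[OF N(1)])
        qed
        show "\<exists>z. C z" if C: "C \<in> K" for C using C contra unfolding K_def by blast
        show "\<exists>C''\<in>K. \<forall>z. C'' z \<longrightarrow> C z \<and> C' z" if C: "C \<in> K" "C' \<in> K" for C C'
        proof -
          obtain A A' where A: "nbhd x A" "C = (\<lambda>z. A z \<and> Y z \<and> \<not> N z)"
            "nbhd x A'" "C' = (\<lambda>z. A' z \<and> Y z \<and> \<not> N z)" using C unfolding K_def by blast
          obtain A'' where A'': "nbhd x A''" "\<forall>z. A'' z \<longrightarrow> A z \<and> A' z"
            using nbhd_directed[OF A(1,3)] by blast
          show ?thesis using A'' A(2,4) by (intro bexI[OF _ K[OF A''(1)]]) blast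
        qed
        \<comment> \<open>The lower bounds of members become definable once the member is given by
          its index \<open>u\<close>.\<close>
        have "D (\<lambda>e. \<exists>u. length u = m \<and> U u \<and> B u x \<and> (\<forall>z. B u z \<and> Y z \<and> \<not> N z \<longrightarrow> \<not> z \<sqsubset> e 0))"
          by (rule D_ex_list) (intro D_intros D_U D_B D_app1[OF Y(1)] D_app1[OF N(1)])
        moreover have "(\<exists>C\<in>K. \<forall>z. C z \<longrightarrow> \<not> z \<sqsubset> s) \<longleftrightarrow>
          (\<exists>u. length u = m \<and> U u \<and> B u x \<and> (\<forall>z. B u z \<and> Y z \<and> \<not> N z \<longrightarrow> \<not> z \<sqsubset> s))" for s
        proof -
          have "(\<exists>C\<in>K. \<forall>z. C z \<longrightarrow> \<not> z \<sqsubset> s) \<longleftrightarrow>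
            (\<exists>A. nbhd x A \<and> (\<forall>z. A z \<and> Y z \<and> \<not> N z \<longrightarrow> \<not> z \<sqsubset> s))"
            unfolding K_def by auto
          then show ?thesis unfolding nbhd_def by auto
        qed
        ultimately show "def1 (\<lambda>s. \<exists>C\<in>K. \<forall>z. C z \<longrightarrow> \<not> z \<sqsubset> s)" by simp
      qed
      then consider (point) y where "\<forall>C\<in>K. C y" | (right) y where "\<forall>C\<in>K. germ lt y C"
        | (left) y where "\<forall>C\<in>K. germ gt y C"
        | (top) "\<forall>C\<in>K. \<forall>w. \<exists>z. w \<sqsubset> z \<and> C z" | (bot) "\<forall>C\<in>K. \<forall>w. \<exists>z. z \<sqsubset> w \<and> C z" by blast
      then show False
      proof cases
        \<comment> \<open>A common point \<open>y\<close> lies in every neighbourhood of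
          \<open>x\<close> but outside \<open>N\<close>; so it differs from \<open>x\<close> and
          cannot be separated from it.\<close>
        case point
        have y: "A y \<and> \<not> N y" if "nbhd x A" for A using point[rule_format, OF K[OF that]] by blast
        obtain A where A: "nbhd x A" using x(2) unfolding inspace_def by blast
        have "x \<noteq> y" using y[OF A] N(2) by blast
        moreover have "inspace y" using nbhd_other[OF A] y[OF A] unfolding inspace_def by blast
        ultimately show False using nbhd_separate[OF x(2)] y nbhd_self by metis
      next
        case right
        have gA: "germ lt y A" "germ lt y Y" "germ lt y (\<lambda>z. \<not> N z)" if "nbhd x A" for A
          by (rule germ_mono[OF right[rule_format, OF K[OF that]]], blast)+
        have adh: "adherent lt x y" using gA x(2) unfolding adherent_def by blast
        \<comment> \<open>Otherwise \<open>x\<close> would be adherent to a cut point and belong to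
          \<open>F2\<close>.\<close>
        have "y \<notin> FR" using adh Y(2) x(1) unfolding F_def F2_def by blast
        obtain A where A: "nbhd x A" using x(2) unfolding inspace_def by blast
        have "y = x"
        proof (rule adherent_in_piece)
          show "x' = y'" if "\<forall>f\<in>FR. f \<sqsubset> x' \<and> f \<sqsubset> y' \<or> x' \<sqsubset> f \<and> y' \<sqsubset> f" "adherent lt x' y'" for x' y'
            using FR(2) that .
          show "\<not> Y f" if "f \<in> FR" for f using Y(2) that unfolding F_def by blast
        qed (use convex in blast | fact \<open>y \<notin> FR\<close> x(1) gA(2)[OF A] adh)+
        then show False using gA(3)[OF A] adh N(3) germ_ex[OF germ_conj, of x N "\<lambda>z. \<not> N z"] by blast
      next
        case left
        have gA: "germ gt y A" "germ gt y Y" "germ gt y (\<lambda>z. \<not> N z)" if "nbhd x A" for A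
          by (rule germ_gt_mono[OF left[rule_format, OF K[OF that]]], blast)+
        have adh: "adherent gt x y" using gA x(2) unfolding adherent_def by blast
        have "y \<notin> FL" using adh Y(2) x(1) unfolding F_def F2_def by blast
        obtain A where A: "nbhd x A" using x(2) unfolding inspace_def by blast
        have "y = x"
        proof (rule left_adherent_in_piece)
          show "x' = y'" if "\<forall>f\<in>FL. x' \<sqsubset> f \<and> y' \<sqsubset> f \<or> f \<sqsubset> x' \<and> f \<sqsubset> y'" "adherent gt x' y'" for x' y'
            using FL(2) that .
          show "\<not> Y f" if "f \<in> FL" for f using Y(2) that unfolding F_def by blast
        qed (use convex in blast | fact \<open>y \<notin> FL\<close> x(1) gA(2)[OF A] adh)+
        then show False using gA(3)[OF A] adh N(4) germ_gt_ex[OF germ_gt_conj, of x N "\<lambda>z. \<not> N z"] by blast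
      next
        \<comment> \<open>Here \<open>x\<close> is adherent to the upper end of the order and would
          have been cut out with \<open>F3\<close>.\<close>
        case top
        have "\<exists>z. w \<sqsubset> z \<and> A z" if "nbhd x A" for A w using top[rule_format, OF K[OF that]] by blast
        then have "x \<in> F3" using x(2) unfolding F3_def by blast
        then show False using Y(2) x(1) unfolding F_def by blast
      next
        case bot
        have "\<exists>z. z \<sqsubset> w \<and> A z" if "nbhd x A" for A w using bot[rule_format, OF K[OF that]] by blast
        then have "x \<in> F3" using x(2) unfolding F3_def by blast
        then show False using Y(2) x(1) unfolding F_def by blast
      qed
    qed
  qed (rule \<open>finite F\<close>)
qed

end

section \<open>Definability by formulas\<close>

primrec rename_tm :: "(nat \<Rightarrow> nat) \<Rightarrow> 'f tm \<Rightarrow> 'f tm" where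
  "rename_tm r (Var i) = Var (r i)"
| "rename_tm r (Fun f ts) = Fun f (map (rename_tm r) ts)"

primrec rename_fm :: "(nat \<Rightarrow> nat) \<Rightarrow> ('f, 'r) fm \<Rightarrow> ('f, 'r) fm" where
  "rename_fm r (Eq s t) = Eq (rename_tm r s) (rename_tm r t)"
| "rename_fm r (Less s t) = Less (rename_tm r s) (rename_tm r t)"
| "rename_fm r (Rel R ts) = Rel R (map (rename_tm r) ts)"
| "rename_fm r (Neg \<phi>) = Neg (rename_fm r \<phi>)"
| "rename_fm r (Conj \<phi> \<psi>) = Conj (rename_fm r \<phi>) (rename_fm r \<psi>)"
| "rename_fm r (Exists \<phi>) = Exists (rename_fm (case_nat 0 (\<lambda>i. Suc (r i))) \<phi>)"

lemma wf_rename_tm: "wf_tm M (rename_tm r t) = wf_tm M t"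
  by (induction t) (auto simp: list_all_iff)

lemma wf_rename_fm: "wf_fm M (rename_fm r \<phi>) = wf_fm M \<phi>"
  by (induction \<phi> arbitrary: r) (auto simp: list_all_iff wf_rename_tm)

lemma val_rename_tm: "val_tm M e (rename_tm r t) = val_tm M (\<lambda>i. e (r i)) t"
  by (induction t) (auto cong: map_cong)

lemma sat_rename_fm: "sat M e (rename_fm r \<phi>) = sat M (\<lambda>i. e (r i)) \<phi>"
proof (induction \<phi> arbitrary: r e)
  case (Exists \<phi>)
  have "(\<lambda>i. case_nat a e (case_nat 0 (\<lambda>i. Suc (r i)) i)) = case_nat a (\<lambda>i. e (r i))" for a
    by (auto split: nat.split)
  then show ?case using Exists by simp
qed (auto simp: val_rename_tm comp_def)

text \<open>The value of a variable of the formula is either read off the environment or a parameter.\<close>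

definition definable_predicate ::
  "('f, 'r, 'a::linorder) expansion \<Rightarrow> ((nat \<Rightarrow> 'a) \<Rightarrow> bool) \<Rightarrow> bool" where
  "definable_predicate M P \<longleftrightarrow>
     (\<exists>\<phi> \<sigma>. wf_fm M \<phi> \<and> (\<forall>e. P e \<longleftrightarrow> sat M (\<lambda>i. case_sum e id (\<sigma> i)) \<phi>))"

lemma definable_predicateI:
  "wf_fm M \<phi> \<Longrightarrow> (\<And>e. P e \<longleftrightarrow> sat M (\<lambda>i. case_sum e id (\<sigma> i)) \<phi>) \<Longrightarrow> definable_predicate M P"
  unfolding definable_predicate_def by blast

lemma definable_predicate_less: "definable_predicate M (\<lambda>e. e 0 < e 1)"
  by (rule definable_predicateI[of _ "Less (Var 0) (Var 1)" _ Inl]) auto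

lemma definable_predicate_not:
  assumes "definable_predicate M P"
  shows "definable_predicate M (\<lambda>e. \<not> P e)"
proof -
  obtain \<phi> \<sigma> where \<phi>: "wf_fm M \<phi>" "\<And>e. P e \<longleftrightarrow> sat M (\<lambda>i. case_sum e id (\<sigma> i)) \<phi>"
    using assms unfolding definable_predicate_def by blast
  show ?thesis by (rule definable_predicateI[of _ "Neg \<phi>" _ \<sigma>]) (auto simp: \<phi>)
qed

lemma definable_predicate_conj:
  assumes "definable_predicate M P" "definable_predicate M Q"
  shows "definable_predicate M (\<lambda>e. P e \<and> Q e)"
proof -
  obtain \<phi> \<sigma> where \<phi>: "wf_fm M \<phi>" "\<And>e. P e \<longleftrightarrow> sat M (\<lambda>i. case_sum e id (\<sigma> i)) \<phi>"
    using assms(1) unfolding definable_predicate_def by blast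
  obtain \<psi> \<tau> where \<psi>: "wf_fm M \<psi>" "\<And>e. Q e \<longleftrightarrow> sat M (\<lambda>i. case_sum e id (\<tau> i)) \<psi>"
    using assms(2) unfolding definable_predicate_def by blast
  \<comment> \<open>Even and odd indices keep the variables of the two formulas apart, since
    \<open>\<sigma>\<close> and \<open>\<tau>\<close> may interpret the same variable
    differently.\<close>
  define \<rho> where "\<rho> k = (if even k then \<sigma> (k div 2) else \<tau> (k div 2))" for k
  have "\<rho> (2 * i) = \<sigma> i" "\<rho> (Suc (2 * i)) = \<tau> i" for i
    unfolding \<rho>_def by simp_all
  then show ?thesis
    by (intro definable_predicateI[of _ "Conj (rename_fm (\<lambda>i. 2 * i) \<phi>) (rename_fm (\<lambda>i. Suc (2 * i)) \<psi>)" _ \<rho>])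
      (auto simp: \<phi> \<psi> wf_rename_fm sat_rename_fm)
qed

lemma definable_predicate_ex:
  assumes "definable_predicate M (\<lambda>e. S (\<lambda>i. e (Suc i)) (e 0))"
  shows "definable_predicate M (\<lambda>e. \<exists>a. S e a)"
proof -
  obtain \<phi> \<sigma> where \<phi>: "wf_fm M \<phi>"
    "\<And>e. S (\<lambda>i. e (Suc i)) (e 0) \<longleftrightarrow> sat M (\<lambda>i. case_sum e id (\<sigma> i)) \<phi>"
    using assms unfolding definable_predicate_def by blast
  \<comment> \<open>All variables that read entry 0 become the bound variable; the others shift past
    it, and \<open>\<tau>\<close> lowers the entries they read by one.\<close>
  define r where "r i = (if \<sigma> i = Inl 0 then 0 else Suc i)" for i
  define \<tau> where "\<tau> i = (case \<sigma> i of Inl k \<Rightarrow> Inl (k - 1) | Inr a \<Rightarrow> Inr a)" for i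
  have "case_nat a (\<lambda>i. case_sum e id (\<tau> i)) (r i) = case_sum (case_nat a e) id (\<sigma> i)" for a e i
    unfolding r_def \<tau>_def by (auto split: sum.split nat.split)
  moreover have "S e a \<longleftrightarrow> sat M (\<lambda>i. case_sum (case_nat a e) id (\<sigma> i)) \<phi>" for e a
    using \<phi>(2)[of "case_nat a e"] by simp
  ultimately show ?thesis
    by (intro definable_predicateI[of _ "Exists (rename_fm r \<phi>)" _ \<tau>])
      (auto simp: \<phi>(1) wf_rename_fm sat_rename_fm)
qed

lemma definable_predicate_subst:
  assumes "definable_predicate M P" "\<And>i. is_variable_or_constant (s i)"
  shows "definable_predicate M (\<lambda>e. P (\<lambda>i. s i e))"
proof -
  obtain \<phi> \<sigma> where \<phi>: "wf_fm M \<phi>" "\<And>e. P e \<longleftrightarrow> sat M (\<lambda>i. case_sum e id (\<sigma> i)) \<phi>"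
    using assms(1) unfolding definable_predicate_def by blast
  have "\<exists>v. \<forall>e. s i e = case_sum e id v" for i
  proof -
    consider k where "s i = (\<lambda>e. e k)" | c where "s i = (\<lambda>e. c)"
      using assms(2)[of i] unfolding is_variable_or_constant_def by blast
    then show ?thesis
    proof cases
      case 1
      then show ?thesis by (intro exI[of _ "Inl k"]) simp
    next
      case 2
      then show ?thesis by (intro exI[of _ "Inr c"]) simp
    qed
  qed
  then obtain \<tau> where \<tau>: "\<And>i e. s i e = case_sum e id (\<tau> i)" by metis
  show ?thesis
    by (rule definable_predicateI[of _ \<phi> _ "\<lambda>i. case_sum \<tau> Inr (\<sigma> i)"])
      (auto simp: \<phi> \<tau> intro!: arg_cong[of _ _ "\<lambda>e. sat M e \<phi>"] split: sum.split)
qed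

lemma definable_predicate_mem:
  assumes "definable M n A"
  shows "definable_predicate M (\<lambda>e. map e [0..<n] \<in> A)"
proof -
  obtain \<phi> p where \<phi>: "wf_fm M \<phi>" "A = {xs \<in> power_space n. sat M (assignment xs p) \<phi>}"
    using assms unfolding definable_def by blast
  have "assignment (map e [0..<n]) p = (\<lambda>i. case_sum e id (if i < n then Inl i else Inr (p (i - n))))" for e
    unfolding assignment_def by auto
  then show ?thesis
    by (intro definable_predicateI[of _ \<phi> _ "\<lambda>i. if i < n then Inl i else Inr (p (i - n))"])
      (auto simp: \<phi> power_space_def)
qed

text \<open>The way back from predicates to definable sets, needed to apply
  \<open>o_minimal\<close>.\<close>

lemma definable_line:
  fixes M :: "('f, 'r, 'a::linorder) expansion"
  assumes "definable_predicate M (\<lambda>e. A (e 0))"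
  shows "definable M 1 ((\<lambda>x. [x]) ` {x. A x})"
proof -
  obtain \<phi> and \<sigma> :: "nat \<Rightarrow> nat + 'a" where \<phi>: "wf_fm M \<phi>" "\<And>e. A (e 0) \<longleftrightarrow> sat M (\<lambda>i. case_sum e id (\<sigma> i)) \<phi>"
    using assms unfolding definable_predicate_def by blast
  define r where "r i = (if \<sigma> i = Inl 0 then 0 else Suc i)" for i
  \<comment> \<open>Since \<open>A (e 0)\<close> depends on entry 0 alone, variables reading any
    other entry can be turned into parameters with the fixed value \<open>undefined\<close>.\<close>
  define p where "p i = case_sum (\<lambda>_. undefined) id (\<sigma> i)" for i
  have "assignment [x] p (r i) = case_sum (case_nat x (\<lambda>_. undefined)) id (\<sigma> i)" for x i
    unfolding r_def p_def assignment_def by (auto split: sum.split nat.split)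
  then have "A x \<longleftrightarrow> sat M (assignment [x] p) (rename_fm r \<phi>)" for x
    using \<phi>(2)[of "case_nat x (\<lambda>_. undefined)"] by (simp add: sat_rename_fm)
  then have "(\<lambda>x. [x]) ` {x. A x} = {xs \<in> power_space 1. sat M (assignment xs p) (rename_fm r \<phi>)}"
    by (auto simp: power_space_def length_Suc_conv)
  then show ?thesis unfolding definable_def using \<phi>(1) wf_rename_fm by blast
qed

text \<open>Taking the endpoints as exceptional points turns finite unions of points and intervals
  into the form of o-minimality used in \<open>omin_order\<close>.\<close>

lemma point_or_interval_endpoints:
  assumes "point_or_interval Y"
  shows "\<exists>F. finite F \<and> (\<forall>x y. x < y \<longrightarrow> (\<forall>f\<in>F. \<not> (x \<le> f \<and> f \<le> y)) \<longrightarrow> (x \<in> Y \<longleftrightarrow> y \<in> Y))"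
proof -
  consider (point) a where "Y = {a}" | (ab) a b where "Y = {a<..<b}" | (a) a where "Y = {a<..}"
    | (b) b where "Y = {..<b}" | (top) "Y = UNIV"
    using assms unfolding point_or_interval_def open_interval_def by blast
  then show ?thesis
  proof cases
    case point
    then show ?thesis by (intro exI[of _ "{a}"]) auto
  next
    case ab
    then show ?thesis by (intro exI[of _ "{a, b}"]) auto
  next
    case a
    then show ?thesis by (intro exI[of _ "{a}"]) auto
  next
    case b
    then show ?thesis by (intro exI[of _ "{b}"]) auto
  next
    case top
    then show ?thesis by (intro exI[of _ "{}"]) auto
  qed
qed

lemma omin_order_definable_predicate:
  fixes M :: "('f, 'r, 'a::unbounded_dense_linorder) expansion"
  assumes "o_minimal M"
  shows "omin_order (\<le>) (<) (definable_predicate M)"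
proof
  fix A :: "'a \<Rightarrow> bool" assume "definable_predicate M (\<lambda>e. A (e 0))"
  then have "definable M 1 ((\<lambda>x. [x]) ` {x. A x})" by (rule definable_line)
  from assms[unfolded o_minimal_def, THEN spec, THEN mp, OF this] obtain \<F> where \<F>: "finite \<F>" "\<forall>Y\<in>\<F>. point_or_interval Y" "{x. A x} = \<Union>\<F>"
    by (elim exE conjE)
  then obtain G where G: "\<forall>Y\<in>\<F>. finite (G Y) \<and>
      (\<forall>x y. x < y \<longrightarrow> (\<forall>f\<in>G Y. \<not> (x \<le> f \<and> f \<le> y)) \<longrightarrow> (x \<in> Y \<longleftrightarrow> y \<in> Y))"
    using point_or_interval_endpoints by metis
  have A: "A x \<longleftrightarrow> (\<exists>Y\<in>\<F>. x \<in> Y)" for x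
  proof -
    have "x \<in> {x. A x} \<longleftrightarrow> x \<in> \<Union>\<F>" by (simp only: \<F>(3))
    then show ?thesis by simp
  qed
  show "\<exists>F. finite F \<and> (\<forall>x y. x < y \<longrightarrow> (\<forall>f\<in>F. \<not> (x \<le> f \<and> f \<le> y)) \<longrightarrow> A x = A y)"
  proof (intro exI[of _ "\<Union>(G ` \<F>)"] conjI allI impI)
    show "finite (\<Union>(G ` \<F>))" using G \<F>(1) by simp
    fix x y assume xy: "x < y" "\<forall>f\<in>\<Union>(G ` \<F>). \<not> (x \<le> f \<and> f \<le> y)"
    have "x \<in> Y \<longleftrightarrow> y \<in> Y" if "Y \<in> \<F>" for Y
    proof -
      have "\<forall>f\<in>G Y. \<not> (x \<le> f \<and> f \<le> y)" using xy(2) that by blast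
      then show ?thesis using bspec[OF G that] xy(1) by simp
    qed
    then show "A x = A y" unfolding A by blast
  qed
qed (fact definable_predicate_less definable_predicate_not definable_predicate_conj
    definable_predicate_ex definable_predicate_subst)+

section \<open>Neighbourhood bases\<close>

text \<open>Directedness of each \<open>N x\<close> absorbs the finite intersections in the
  generation of the topology, so it suffices to check the generators.\<close>

lemma openin_topology_generated_by_nbhds:
  assumes sub: "\<And>s x. s \<in> S \<Longrightarrow> x \<in> s \<Longrightarrow> \<exists>n\<in>N x. n \<subseteq> s"
    and int: "\<And>x n n'. n \<in> N x \<Longrightarrow> n' \<in> N x \<Longrightarrow> \<exists>n''\<in>N x. n'' \<subseteq> n \<inter> n'"
    and op: "\<And>x n. n \<in> N x \<Longrightarrow> openin (topology_generated_by S) n \<and> x \<in> n"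
  shows "openin (topology_generated_by S) V \<longleftrightarrow> (\<forall>x\<in>V. \<exists>n\<in>N x. n \<subseteq> V)"
proof
  assume "openin (topology_generated_by S) V"
  then have "generate_topology_on S V" by (simp add: openin_topology_generated_by_iff)
  then show "\<forall>x\<in>V. \<exists>n\<in>N x. n \<subseteq> V"
  proof induction
    case (Int a b)
    show ?case
    proof
      fix x assume x: "x \<in> a \<inter> b"
      then obtain n n' where n: "n \<in> N x" "n' \<in> N x" "n \<subseteq> a" "n' \<subseteq> b" using Int.IH by blast
      then obtain n'' where "n'' \<in> N x" "n'' \<subseteq> n \<inter> n'" using int by blast
      then show "\<exists>n\<in>N x. n \<subseteq> a \<inter> b" using n by blast
    qed
  next
    case (UN K)
    then show ?case by (meson Union_iff Union_upper order_trans)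
  qed (use sub in auto)
next
  assume *: "\<forall>x\<in>V. \<exists>n\<in>N x. n \<subseteq> V"
  show "openin (topology_generated_by S) V"
    by (subst openin_subopen) (use * op in blast)
qed

lemma openin_subtopology_nbhds:
  assumes "\<And>V. openin T V \<longleftrightarrow> (\<forall>x\<in>V. \<exists>n\<in>N x. n \<subseteq> V)"
    and "\<And>x n. n \<in> N x \<Longrightarrow> openin T n \<and> x \<in> n"
  shows "openin (subtopology T Y) W \<longleftrightarrow> W \<subseteq> Y \<and> (\<forall>x\<in>W. \<exists>n\<in>N x. n \<inter> Y \<subseteq> W)"
proof
  assume "openin (subtopology T Y) W"
  then obtain V where V: "openin T V" "W = V \<inter> Y" unfolding openin_subtopology by blast
  then have "\<forall>x\<in>V. \<exists>n\<in>N x. n \<subseteq> V" using assms(1)[of V] by simp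
  then show "W \<subseteq> Y \<and> (\<forall>x\<in>W. \<exists>n\<in>N x. n \<inter> Y \<subseteq> W)" using V(2) by blast
next
  assume W: "W \<subseteq> Y \<and> (\<forall>x\<in>W. \<exists>n\<in>N x. n \<inter> Y \<subseteq> W)"
  have "\<exists>V. openin (subtopology T Y) V \<and> x \<in> V \<and> V \<subseteq> W" if x: "x \<in> W" for x
  proof -
    obtain n where n: "n \<in> N x" "n \<inter> Y \<subseteq> W" using W x by blast
    then have "openin (subtopology T Y) (n \<inter> Y)" "x \<in> n \<inter> Y"
      using assms(2)[of n x] openin_subtopology_Int[of T n Y] W x by blast+
    then show ?thesis using n(2) by blast
  qed
  then show "openin (subtopology T Y) W" by (meson openin_subopen)
qed

text \<open>Refinement is compared only after intersection with \<open>Y\<close>, because the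
  behaviour of the topology is controlled only inside a piece.\<close>

lemma subtopology_eq_nbhds:
  fixes T T' :: "'a topology"
  assumes "\<And>V. openin T V \<longleftrightarrow> (\<forall>x\<in>V. \<exists>n\<in>N x. n \<subseteq> V)" "\<And>x n. n \<in> N x \<Longrightarrow> openin T n \<and> x \<in> n"
    and "\<And>V. openin T' V \<longleftrightarrow> (\<forall>x\<in>V. \<exists>n\<in>N' x. n \<subseteq> V)" "\<And>x n. n \<in> N' x \<Longrightarrow> openin T' n \<and> x \<in> n"
    and "\<And>x n. x \<in> Y \<Longrightarrow> n \<in> N x \<Longrightarrow> \<exists>n'\<in>N' x. n' \<inter> Y \<subseteq> n"
    and "\<And>x n'. x \<in> Y \<Longrightarrow> n' \<in> N' x \<Longrightarrow> \<exists>n\<in>N x. n \<inter> Y \<subseteq> n'"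
  shows "subtopology T Y = subtopology T' Y"
proof -
  have *: "\<forall>x\<in>W. \<exists>n\<in>N2 x. n \<inter> Y \<subseteq> W"
    if refine: "\<And>x n. x \<in> Y \<Longrightarrow> n \<in> N1 x \<Longrightarrow> \<exists>n'\<in>N2 x. n' \<inter> Y \<subseteq> n"
      and W: "W \<subseteq> Y" "\<forall>x\<in>W. \<exists>n\<in>N1 x. n \<inter> Y \<subseteq> W"
    for W and N1 N2 :: "'a \<Rightarrow> 'a set set"
  proof
    fix x assume "x \<in> W"
    then obtain n where n: "x \<in> Y" "n \<in> N1 x" "n \<inter> Y \<subseteq> W" using W by blast
    then show "\<exists>n\<in>N2 x. n \<inter> Y \<subseteq> W" using refine[OF n(1,2)] by blast
  qed
  have T: "openin (subtopology T Y) W \<longleftrightarrow> W \<subseteq> Y \<and> (\<forall>x\<in>W. \<exists>n\<in>N x. n \<inter> Y \<subseteq> W)" for W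
    using assms(1,2) by (rule openin_subtopology_nbhds)
  have T': "openin (subtopology T' Y) W \<longleftrightarrow> W \<subseteq> Y \<and> (\<forall>x\<in>W. \<exists>n\<in>N' x. n \<inter> Y \<subseteq> W)" for W
    using assms(3,4) by (rule openin_subtopology_nbhds)
  have "openin (subtopology T Y) W \<longleftrightarrow> openin (subtopology T' Y) W" for W
  proof (cases "W \<subseteq> Y")
    case True
    have "(\<forall>x\<in>W. \<exists>n\<in>N x. n \<inter> Y \<subseteq> W) \<longleftrightarrow> (\<forall>x\<in>W. \<exists>n\<in>N' x. n \<inter> Y \<subseteq> W)"
    proof
      assume "\<forall>x\<in>W. \<exists>n\<in>N x. n \<inter> Y \<subseteq> W"
      then show "\<forall>x\<in>W. \<exists>n\<in>N' x. n \<inter> Y \<subseteq> W" using assms(5) True by (rule *[rotated 2])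
    next
      assume "\<forall>x\<in>W. \<exists>n\<in>N' x. n \<inter> Y \<subseteq> W"
      then show "\<forall>x\<in>W. \<exists>n\<in>N x. n \<inter> Y \<subseteq> W" using assms(6) True by (rule *[rotated 2])
    qed
    then show ?thesis unfolding T T' by simp
  qed (simp add: T T')
  then show ?thesis unfolding topology_eq by blast
qed

section \<open>Neighbourhood bases of the order topology and the half-open interval
  topologies\<close>

abbreviation order_topology :: "'a::linorder topology" where
  "order_topology \<equiv> topology_generated_by (range lessThan \<union> range greaterThan)"

lemma openin_order_interval: "openin order_topology {c<..<d :: 'a::linorder}"
proof -
  have "openin order_topology {c<..}" "openin order_topology {..<d}"
    by (intro topology_generated_by_Basis; blast)+
  then have "openin order_topology ({c<..} \<inter> {..<d})" by (rule openin_Int)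
  then show ?thesis by (simp add: greaterThanLessThan_def)
qed

lemma openin_order_topology:
  fixes V :: "'a::unbounded_dense_linorder set"
  shows "openin order_topology V \<longleftrightarrow> (\<forall>x\<in>V. \<exists>n\<in>{{c<..<d} | c d. c < x \<and> x < d}. n \<subseteq> V)"
proof (rule openin_topology_generated_by_nbhds)
  fix s :: "'a set" and x assume "s \<in> range lessThan \<union> range greaterThan" "x \<in> s"
  then consider b where "s = {..<b}" "x < b" | a where "s = {a<..}" "a < x" by auto
  then show "\<exists>n\<in>{{c<..<d} | c d. c < x \<and> x < d}. n \<subseteq> s"
  proof cases
    case 1
    obtain c where "c < x" using lt_ex by blast
    then show ?thesis using 1 by (intro bexI[of _ "{c<..<b}"]) auto
  next
    case 2
    obtain d where "x < d" using gt_ex by blast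
    then show ?thesis using 2 by (intro bexI[of _ "{a<..<d}"]) auto
  qed
next
  fix x :: 'a and n n'
  assume "n \<in> {{c<..<d} | c d. c < x \<and> x < d}" "n' \<in> {{c<..<d} | c d. c < x \<and> x < d}"
  then obtain c d c' d' where "n = {c<..<d}" "n' = {c'<..<d'}" "c < x" "c' < x" "x < d" "x < d'" by blast
  then show "\<exists>n''\<in>{{c<..<d} | c d. c < x \<and> x < d}. n'' \<subseteq> n \<inter> n'"
  proof (intro bexI[of _ "{max c c'<..<min d d'}"])
    have "max c c' < x" "x < min d d'" using \<open>c < x\<close> \<open>c' < x\<close> \<open>x < d\<close> \<open>x < d'\<close> by simp_all
    then show "{max c c'<..<min d d'} \<in> {{c<..<d} | c d. c < x \<and> x < d}" by blast
  qed auto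
qed (use openin_order_interval in auto)

lemma openin_right_half_open_topology:
  fixes V :: "'a::unbounded_dense_linorder set"
  shows "openin (topology_generated_by {{x..<y} | x y. x < y}) V \<longleftrightarrow>
    (\<forall>x\<in>V. \<exists>n\<in>{{x..<d} | d. x < d}. n \<subseteq> V)"
proof (rule openin_topology_generated_by_nbhds)
  fix x :: 'a and n n' assume "n \<in> {{x..<d} | d. x < d}" "n' \<in> {{x..<d} | d. x < d}"
  then obtain d d' where "n = {x..<d}" "n' = {x..<d'}" "x < d" "x < d'" by blast
  then show "\<exists>n''\<in>{{x..<d} | d. x < d}. n'' \<subseteq> n \<inter> n'" by (intro bexI[of _ "{x..<min d d'}"]) auto
next
  fix s and x :: 'a assume "s \<in> {{x..<y} | x y. x < y}" "x \<in> s"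
  then obtain a b where "s = {a..<b}" "a \<le> x" "x < b" by auto
  then show "\<exists>n\<in>{{x..<d} | d. x < d}. n \<subseteq> s" by (intro bexI[of _ "{x..<b}"]) auto
next
  fix x :: 'a and n assume "n \<in> {{x..<d} | d. x < d}"
  then show "openin (topology_generated_by {{x..<y} | x y. x < y}) n \<and> x \<in> n"
    by (auto intro!: topology_generated_by_Basis)
qed

lemma openin_left_half_open_topology:
  fixes V :: "'a::unbounded_dense_linorder set"
  shows "openin (topology_generated_by {{x<..y} | x y. x < y}) V \<longleftrightarrow>
    (\<forall>x\<in>V. \<exists>n\<in>{{c<..x} | c. c < x}. n \<subseteq> V)"
proof (rule openin_topology_generated_by_nbhds)
  fix x :: 'a and n n' assume "n \<in> {{c<..x} | c. c < x}" "n' \<in> {{c<..x} | c. c < x}"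
  then obtain c c' where "n = {c<..x}" "n' = {c'<..x}" "c < x" "c' < x" by blast
  then show "\<exists>n''\<in>{{c<..x} | c. c < x}. n'' \<subseteq> n \<inter> n'" by (intro bexI[of _ "{max c c'<..x}"]) auto
next
  fix s and x :: 'a assume "s \<in> {{x<..y} | x y. x < y}" "x \<in> s"
  then obtain a b where "s = {a<..b}" "a < x" "x \<le> b" by auto
  then show "\<exists>n\<in>{{c<..x} | c. c < x}. n \<subseteq> s" by (intro bexI[of _ "{a<..x}"]) auto
next
  fix x :: 'a and n assume "n \<in> {{c<..x} | c. c < x}"
  then show "openin (topology_generated_by {{x<..y} | x y. x < y}) n \<and> x \<in> n"
    by (auto intro!: topology_generated_by_Basis)
qed

lemma openin_pullback_line_image:
  "openin (pullback_topology (power_space 1) hd T) ((\<lambda>x. [x]) ` V) \<longleftrightarrow> openin T V"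
proof -
  have "(\<lambda>x. [x]) ` V = (\<lambda>x. [x]) ` V' \<longleftrightarrow> V = V'" for V' :: "'a set"
    by (rule inj_image_eq_iff) (simp add: inj_def)
  then show ?thesis unfolding openin_pullback_line by metis
qed

section \<open>The partition\<close>

text \<open>For \<open>x\<close> outside \<open>F\<close>, this is the convex component of the
  complement of \<open>F\<close> around \<open>x\<close>. Describing it by the points of
  \<open>F\<close> below it leaves finitely many possibilities and makes overlapping gaps
  equal.\<close>

definition gap :: "'a::linorder set \<Rightarrow> 'a \<Rightarrow> 'a set" where
  "gap F x = {y. y \<notin> F \<and> F \<inter> {..<y} = F \<inter> {..<x}}"

lemma mem_gap: "y \<in> gap F x \<longleftrightarrow> (\<forall>f\<in>F. f \<noteq> y \<and> (f < y \<longleftrightarrow> f < x))"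
  unfolding gap_def by auto

text \<open>The ends are the nearest points of \<open>F\<close> on either side of \<open>x\<close>,
  and infinite where there are none.\<close>

lemma open_interval_gap:
  assumes F: "finite F" and x: "x \<notin> F"
  shows "open_interval (gap F x)"
proof -
  have "y \<in> gap F x \<longleftrightarrow> (\<forall>f\<in>F. f < x \<longrightarrow> f < y) \<and> (\<forall>f\<in>F. x < f \<longrightarrow> y < f)" for y
    unfolding mem_gap using x by (metis linorder_neqE order_less_asym order_less_irrefl)
  then have gap: "gap F x = {y. \<forall>f\<in>F. f < x \<longrightarrow> f < y} \<inter> {y. \<forall>f\<in>F. x < f \<longrightarrow> y < f}"
    by blast
  have lower: "{y. \<forall>f\<in>F. f < x \<longrightarrow> f < y} = UNIV \<or> (\<exists>a<x. {y. \<forall>f\<in>F. f < x \<longrightarrow> f < y} = {a<..})"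
  proof (cases "F \<inter> {..<x} = {}")
    case False
    have "Max (F \<inter> {..<x}) < y \<longleftrightarrow> (\<forall>f\<in>F. f < x \<longrightarrow> f < y)" for y
      using Max_less_iff[OF _ False] F by auto
    then show ?thesis by (intro disjI2 exI[of _ "Max (F \<inter> {..<x})"]) auto
  qed auto
  have upper: "{y. \<forall>f\<in>F. x < f \<longrightarrow> y < f} = UNIV \<or> (\<exists>b>x. {y. \<forall>f\<in>F. x < f \<longrightarrow> y < f} = {..<b})"
  proof (cases "F \<inter> {x<..} = {}")
    case False
    have "y < Min (F \<inter> {x<..}) \<longleftrightarrow> (\<forall>f\<in>F. x < f \<longrightarrow> y < f)" for y
      using Min_gr_iff[OF _ False] F by auto
    then show ?thesis by (intro disjI2 exI[of _ "Min (F \<inter> {x<..})"]) auto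
  qed auto
  from lower show ?thesis
  proof (elim disjE exE conjE)
    assume lo: "{y. \<forall>f\<in>F. f < x \<longrightarrow> f < y} = UNIV"
    from upper show ?thesis
    proof (elim disjE exE conjE)
      assume hi: "{y. \<forall>f\<in>F. x < f \<longrightarrow> y < f} = UNIV"
      show ?thesis unfolding gap lo hi open_interval_def by simp
    next
      fix b assume hi: "{y. \<forall>f\<in>F. x < f \<longrightarrow> y < f} = {..<b}"
      show ?thesis
        unfolding gap lo hi open_interval_def Int_UNIV_left
        by (rule disjI2, rule disjI2, rule disjI1, rule exI, rule refl)
    qed
  next
    fix a assume a: "a < x" and lo: "{y. \<forall>f\<in>F. f < x \<longrightarrow> f < y} = {a<..}"
    from upper show ?thesis
    proof (elim disjE exE conjE)
      assume hi: "{y. \<forall>f\<in>F. x < f \<longrightarrow> y < f} = UNIV"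
      show ?thesis
        unfolding gap lo hi open_interval_def Int_UNIV_right
        by (rule disjI2, rule disjI1, rule exI, rule refl)
    next
      fix b assume b: "x < b" and hi: "{y. \<forall>f\<in>F. x < f \<longrightarrow> y < f} = {..<b}"
      show ?thesis
        unfolding gap lo hi open_interval_def greaterThanLessThan_def
        by (rule disjI1, rule exI, rule exI, rule conjI, rule order_less_trans[OF a b], rule refl)
    qed
  qed
qed

lemma finite_gaps:
  assumes "finite F"
  shows "finite (range (gap F))"
proof (rule finite_subset)
  show "range (gap F) \<subseteq> (\<lambda>G. {y. y \<notin> F \<and> F \<inter> {..<y} = G}) ` Pow F" unfolding gap_def by blast
  show "finite ((\<lambda>G. {y. y \<notin> F \<and> F \<inter> {..<y} = G}) ` Pow F)" using assms by simp
qed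

lemma subtopology_singleton:
  assumes "a \<in> topspace T"
  shows "subtopology T {a} = discrete_topology {a}"
  using assms by (simp add: subtopology_eq_discrete_topology_sing)

theorem theorem5p9:
  fixes M :: "('f, 'r, 'a::unbounded_dense_linorder) expansion"
    and T :: "'a topology"
  assumes "o_minimal M"
    and "definable_topological_space_line M T"
    and "Hausdorff_space T"
  shows "\<exists>P. finite P \<and> partition_on (topspace T) P \<and>
    (\<forall>Y\<in>P. point_or_interval Y \<and>
       (subtopology T Y = order_topology_on Y \<or>
        subtopology T Y = right_half_open_topology_on Y \<or>
        subtopology T Y = left_half_open_topology_on Y \<or>
        subtopology T Y = discrete_topology Y))"
proof -
  interpret omin_order "(\<le>)" "(<)" "definable_predicate M"
    using assms(1) by (rule omin_order_definable_predicate)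
  obtain \<B> where \<B>: "definable_family M 1 \<B>"
    "openin (pullback_topology (power_space 1) hd T) = arbitrary union_of (\<lambda>B. B \<in> \<B>)"
    using assms(2) unfolding definable_topological_space_line_def definable_topological_space_def by blast
  obtain m I G where I: "definable M m I" and G: "definable M (m + 1) G"
    and \<B>_eq: "\<B> = (\<lambda>u. {x \<in> power_space 1. u @ x \<in> G}) ` I"
    using \<B>(1) unfolding definable_family_def by blast
  define B where "B u z \<longleftrightarrow> u @ [z] \<in> G" for u z
  have length: "length u = m" if "u \<in> I" for u
    using I that unfolding definable_def power_space_def by blast
  have \<B>_line: "{x \<in> power_space 1. u @ x \<in> G} = (\<lambda>x. [x]) ` {z. B u z}" for u
    unfolding B_def by (auto simp: power_space_def length_Suc_conv)
  \<comment> \<open>The identification of points with one-element lists is removed here: the sets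
    \<open>B u\<close> with \<open>u\<close> in \<open>I\<close> form a basis of \<open>T\<close>
    itself.\<close>
  have openin_T: "openin T V \<longleftrightarrow> (\<forall>x\<in>V. \<exists>u\<in>I. B u x \<and> {z. B u z} \<subseteq> V)" for V
  proof -
    have "openin T V \<longleftrightarrow> (\<forall>x\<in>V. \<exists>W\<in>\<B>. [x] \<in> W \<and> W \<subseteq> (\<lambda>x. [x]) ` V)"
      unfolding openin_pullback_line_image[symmetric] \<B>(2) arbitrary_union_of_alt by auto
    also have "\<dots> \<longleftrightarrow> (\<forall>x\<in>V. \<exists>u\<in>I. B u x \<and> {z. B u z} \<subseteq> V)"
      unfolding \<B>_eq \<B>_line by (simp add: image_subset_iff image_iff subset_eq)
    finally show ?thesis .
  qed
  have openin_B: "openin T {z. B u z}" if "u \<in> I" for u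
    unfolding openin_T using that by blast
  interpret omin_space "(\<le>)" "(<)" "definable_predicate M" m "\<lambda>u. u \<in> I" B
  proof unfold_locales
    show "definable_predicate M (\<lambda>e. map e [0..<m] \<in> I)"
      using I by (rule definable_predicate_mem)
    show "definable_predicate M (\<lambda>e. B (map e [0..<m]) (e m))"
      using definable_predicate_mem[OF G] unfolding B_def by simp
  next
    fix u v x assume u: "u \<in> I" "B u x" "v \<in> I" "B v x"
    then have "openin T ({z. B u z} \<inter> {z. B v z})" using openin_B by blast
    then obtain w where "w \<in> I" "B w x" "{z. B w z} \<subseteq> {z. B u z} \<inter> {z. B v z}"
      unfolding openin_T using u by blast
    then show "\<exists>w. length w = m \<and> w \<in> I \<and> B w x \<and> (\<forall>z. B w z \<longrightarrow> B u z \<and> B v z)"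
      using length by (intro exI[of _ w]) auto
  next
    fix u v x y assume u: "u \<in> I" "B u x" "v \<in> I" "B v y" "x \<noteq> y"
    then have "x \<in> topspace T" "y \<in> topspace T"
      using openin_subset[OF openin_B] by blast+
    then obtain V W where V: "openin T V" "openin T W" "x \<in> V" "y \<in> W" "disjnt V W"
      using assms(3) u(5) unfolding Hausdorff_space_def by metis
    then obtain u' v' where "u' \<in> I" "B u' x" "{z. B u' z} \<subseteq> V" "v' \<in> I" "B v' y" "{z. B v' z} \<subseteq> W"
      unfolding openin_T by blast
    then show "\<exists>u v. length u = m \<and> u \<in> I \<and> B u x \<and> length v = m \<and> v \<in> I \<and> B v y \<and>
        (\<forall>z. \<not> (B u z \<and> B v z))"
      using V(5) length unfolding disjnt_def by blast
  qed
  have nbhd_iff: "nbhd x A \<longleftrightarrow> (\<exists>u\<in>I. A = B u \<and> B u x)" for x A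
    unfolding nbhd_def using length by blast
  have inspace_iff: "inspace x \<longleftrightarrow> x \<in> topspace T" for x
    unfolding inspace_def nbhd_iff using openin_T[of "topspace T"] openin_subset[OF openin_B] by blast
  have T_nbhds: "openin T V \<longleftrightarrow> (\<forall>x\<in>V. \<exists>n\<in>{{z. A z} | A. nbhd x A}. n \<subseteq> V)" for V
  proof -
    have "{{z. A z} | A. nbhd x A} = (\<lambda>u. {z. B u z}) ` {u \<in> I. B u x}" for x
      unfolding nbhd_iff by auto
    then show ?thesis unfolding openin_T by auto
  qed
  have T_nbhds_open: "openin T n \<and> x \<in> n" if "n \<in> {{z. A z} | A. nbhd x A}" for x n
    using that openin_B unfolding nbhd_iff by blast
  from homogeneous_pieces obtain F where F: "finite F" and pieces: "\<forall>Y. def1 Y \<longrightarrow> (\<forall>f\<in>F. \<not> Y f) \<longrightarrow>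
     (\<forall>x y z. Y x \<longrightarrow> Y z \<longrightarrow> x < y \<longrightarrow> y < z \<longrightarrow> Y y) \<longrightarrow>
     (\<exists>i r l. \<forall>x. Y x \<longrightarrow> (inspace x \<longleftrightarrow> i) \<and> (adherent (<) x x \<longleftrightarrow> r) \<and> (adherent (>) x x \<longleftrightarrow> l)) \<and>
     (\<forall>x N. Y x \<longrightarrow> inspace x \<longrightarrow> def1 N \<longrightarrow> N x \<longrightarrow>
        (adherent (<) x x \<longrightarrow> germ (<) x N) \<longrightarrow> (adherent (>) x x \<longrightarrow> germ (>) x N) \<longrightarrow>
        (\<exists>A. nbhd x A \<and> (\<forall>z. A z \<longrightarrow> Y z \<longrightarrow> N z)))"
    by (elim exE conjE)
  have def1_interval: "def1 (\<lambda>z. z \<in> Y)" if Y: "open_interval Y" for Y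
  proof -
    consider (ab) a b where "Y = {a<..<b}" | (a) a where "Y = {a<..}"
      | (b) b where "Y = {..<b}" | (top) "Y = UNIV"
      using Y unfolding open_interval_def by blast
    then show ?thesis by cases (simp, intro D_intros)+
  qed
  \<comment> \<open>A gap that meets the space lies inside it, because \<open>inspace\<close> is
    constant there. The constants \<open>r\<close> and \<open>l\<close>, the self-adherence of its
    points from the right and from the left, select the topology.\<close>
  have piece: "Y \<subseteq> topspace T \<and> (subtopology T Y = order_topology_on Y \<or>
        subtopology T Y = right_half_open_topology_on Y \<or>
        subtopology T Y = left_half_open_topology_on Y \<or>
        subtopology T Y = discrete_topology Y)"
    if x0: "x0 \<in> topspace T" "x0 \<notin> F" and Y: "Y = gap F x0" for x0 Y
  proof -
    have defY: "def1 (\<lambda>z. z \<in> Y)" unfolding Y using def1_interval open_interval_gap[OF F x0(2)] by blast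
    have avoidY: "\<forall>f\<in>F. f \<notin> Y" unfolding Y mem_gap by blast
    have convexY: "\<forall>x y z. x \<in> Y \<longrightarrow> z \<in> Y \<longrightarrow> x < y \<longrightarrow> y < z \<longrightarrow> y \<in> Y"
      unfolding Y mem_gap by (metis less_trans less_asym less_linear)
    note homogeneous = pieces[THEN spec, of "\<lambda>z. z \<in> Y", THEN mp, OF defY, THEN mp, OF avoidY, THEN mp, OF convexY]
    obtain i r l where irl: "\<And>x. x \<in> Y \<Longrightarrow>
        (inspace x \<longleftrightarrow> i) \<and> (adherent (<) x x \<longleftrightarrow> r) \<and> (adherent (>) x x \<longleftrightarrow> l)"
      using homogeneous[THEN conjunct1] by (elim exE) blast
    note sep = homogeneous[THEN conjunct2, rule_format]
    have "x0 \<in> Y" using x0(2) unfolding Y mem_gap by blast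
    then have i using irl x0(1) inspace_iff by blast
    then have inY: "inspace x" if "x \<in> Y" for x using irl that by blast
    \<comment> \<open>One half of the comparison of neighbourhood bases; \<open>right\<close> and
      \<open>left\<close> below supply intervals inside a given basic neighbourhood for the other
      half.\<close>
    have shrink: "\<exists>n\<in>{{z. A z} | A. nbhd x A}. n \<inter> Y \<subseteq> N"
      if x: "x \<in> Y" and N: "def1 (\<lambda>z. z \<in> N)" "x \<in> N" "r \<longrightarrow> germ (<) x (\<lambda>z. z \<in> N)" "l \<longrightarrow> germ (>) x (\<lambda>z. z \<in> N)"
      for x N
    proof -
      obtain A where "nbhd x A" "\<forall>z. A z \<longrightarrow> z \<in> Y \<longrightarrow> z \<in> N"
        using sep[OF x inY[OF x] N(1,2)] irl[OF x] N(3,4) by blast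
      then show ?thesis by (intro bexI[of _ "{z. A z}"]) auto
    qed
    have right: "\<exists>d>x. \<forall>z. x < z \<longrightarrow> z < d \<longrightarrow> A z" if r "x \<in> Y" "nbhd x A" for x A
      using that irl[OF that(2)] unfolding adherent_def germ_def by blast
    have left: "\<exists>c<x. \<forall>z. c < z \<longrightarrow> z < x \<longrightarrow> A z" if l "x \<in> Y" "nbhd x A" for x A
      using that irl[OF that(2)] unfolding adherent_def germ_def by blast
    consider (both) r l | (right) r "\<not> l" | (left) "\<not> r" l | (none) "\<not> r" "\<not> l" by blast
    then have "subtopology T Y = order_topology_on Y \<or>
        subtopology T Y = right_half_open_topology_on Y \<or>
        subtopology T Y = left_half_open_topology_on Y \<or>
        subtopology T Y = discrete_topology Y"
    proof cases
      case both
      have "subtopology T Y = order_topology_on Y"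
        unfolding order_topology_on_def
      proof (rule subtopology_eq_nbhds[OF T_nbhds T_nbhds_open openin_order_topology])
        fix x n assume x: "x \<in> Y" "n \<in> {{z. A z} | A. nbhd x A}"
        then obtain A where A: "n = {z. A z}" "nbhd x A" by blast
        obtain c d where cd: "c < x" "x < d" "\<And>z. x < z \<Longrightarrow> z < d \<Longrightarrow> A z" "\<And>z. c < z \<Longrightarrow> z < x \<Longrightarrow> A z"
          using right[OF both(1) x(1) A(2)] left[OF both(2) x(1) A(2)] by blast
        then have "{c<..<d} \<subseteq> n" using nbhd_self[OF A(2)] A(1)
          by (metis greaterThanLessThan_iff linorder_cases mem_Collect_eq subsetI)
        then show "\<exists>n'\<in>{{c<..<d} | c d. c < x \<and> x < d}. n' \<inter> Y \<subseteq> n" using cd(1,2) by blast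
      next
        fix x n assume x: "x \<in> Y" "n \<in> {{c<..<d} | c d. c < x \<and> x < d}"
        then obtain c d where cd: "n = {c<..<d}" "c < x" "x < d" by blast
        show "\<exists>n'\<in>{{z. A z} | A. nbhd x A}. n' \<inter> Y \<subseteq> n"
        proof (rule shrink[OF x(1)])
          show "def1 (\<lambda>z. z \<in> n)" unfolding cd greaterThanLessThan_iff by (intro D_intros)
        qed (use cd in \<open>auto simp: germ_def\<close>)
      qed (use openin_order_interval in auto)
      then show ?thesis by blast
    next
      case right': right
      have "subtopology T Y = right_half_open_topology_on Y"
        unfolding right_half_open_topology_on_def
      proof (rule subtopology_eq_nbhds[OF T_nbhds T_nbhds_open openin_right_half_open_topology])
        fix x n assume x: "x \<in> Y" "n \<in> {{z. A z} | A. nbhd x A}"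
        then obtain A where A: "n = {z. A z}" "nbhd x A" by blast
        obtain d where d: "x < d" "\<And>z. x < z \<Longrightarrow> z < d \<Longrightarrow> A z"
          using right[OF right'(1) x(1) A(2)] by blast
        then have "{x..<d} \<subseteq> n" using nbhd_self[OF A(2)] A(1)
          by (metis atLeastLessThan_iff order_le_less mem_Collect_eq subsetI)
        then show "\<exists>n'\<in>{{x..<d} | d. x < d}. n' \<inter> Y \<subseteq> n" using d(1) by blast
      next
        fix x n assume x: "x \<in> Y" "n \<in> {{x..<d} | d. x < d}"
        then obtain d where d: "n = {x..<d}" "x < d" by blast
        show "\<exists>n'\<in>{{z. A z} | A. nbhd x A}. n' \<inter> Y \<subseteq> n"
        proof (rule shrink[OF x(1)])
          show "def1 (\<lambda>z. z \<in> n)" unfolding d atLeastLessThan_iff not_less[symmetric] by (intro D_intros)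
        qed (use d right'(2) in \<open>auto simp: germ_def\<close>)
      qed (auto intro!: topology_generated_by_Basis)
      then show ?thesis by blast
    next
      case left': left
      have "subtopology T Y = left_half_open_topology_on Y"
        unfolding left_half_open_topology_on_def
      proof (rule subtopology_eq_nbhds[OF T_nbhds T_nbhds_open openin_left_half_open_topology])
        fix x n assume x: "x \<in> Y" "n \<in> {{z. A z} | A. nbhd x A}"
        then obtain A where A: "n = {z. A z}" "nbhd x A" by blast
        obtain c where c: "c < x" "\<And>z. c < z \<Longrightarrow> z < x \<Longrightarrow> A z"
          using left[OF left'(2) x(1) A(2)] by blast
        then have "{c<..x} \<subseteq> n" using nbhd_self[OF A(2)] A(1)
          by (metis greaterThanAtMost_iff order_le_less mem_Collect_eq subsetI)
        then show "\<exists>n'\<in>{{c<..x} | c. c < x}. n' \<inter> Y \<subseteq> n" using c(1) by blast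
      next
        fix x n assume x: "x \<in> Y" "n \<in> {{c<..x} | c. c < x}"
        then obtain c where c: "n = {c<..x}" "c < x" by blast
        show "\<exists>n'\<in>{{z. A z} | A. nbhd x A}. n' \<inter> Y \<subseteq> n"
        proof (rule shrink[OF x(1)])
          show "def1 (\<lambda>z. z \<in> n)" unfolding c greaterThanAtMost_iff not_less[symmetric] by (intro D_intros)
        qed (use c left'(1) in \<open>auto simp: germ_def\<close>)
      qed (auto intro!: topology_generated_by_Basis)
      then show ?thesis by blast
    next
      case none
      \<comment> \<open>Written as a subspace of the discrete topology on the whole order, with
        singletons as neighbourhood bases, this case follows the same scheme as the other
        three.\<close>
      have "subtopology T Y = subtopology (discrete_topology UNIV) Y"
      proof (rule subtopology_eq_nbhds[OF T_nbhds T_nbhds_open, where N' = "\<lambda>x. {{x}}"])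
        fix x n assume "x \<in> Y" "n \<in> {{z. A z} | A. nbhd x A}"
        then have "x \<in> n" using T_nbhds_open by blast
        then show "\<exists>n'\<in>{{x}}. n' \<inter> Y \<subseteq> n" by blast
      next
        fix x n assume x: "x \<in> Y" "n \<in> {{x}}"
        show "\<exists>n'\<in>{{z. A z} | A. nbhd x A}. n' \<inter> Y \<subseteq> n"
        proof (rule shrink[OF x(1)])
          show "def1 (\<lambda>z. z \<in> n)" using x(2) by (simp, intro D_intros)
        qed (use none x in auto)
      qed auto
      then show ?thesis by simp
    qed
    then show ?thesis using inY inspace_iff by blast
  qed
  \<comment> \<open>Cut points outside the space are dropped; a gap enters as soon as it meets the
    space, and by \<open>piece\<close> it then lies in it.\<close>
  define P where "P = (\<lambda>a. {a}) ` (F \<inter> topspace T) \<union> gap F ` (topspace T - F)"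
  have self: "x \<in> gap F x" if "x \<notin> F" for x using that unfolding mem_gap by blast
  have gap_eq: "gap F x = gap F y" if "z \<in> gap F x" "z \<in> gap F y" for x y z
    using that unfolding gap_def by blast
  have "partition_on (topspace T) P"
  proof (rule partition_onI)
    have sub: "gap F x \<subseteq> topspace T" if "x \<in> topspace T - F" for x
      using piece[of x "gap F x"] that by simp
    show "\<Union>P = topspace T"
    proof (intro equalityI subsetI)
      fix z assume "z \<in> \<Union>P"
      then show "z \<in> topspace T" unfolding P_def using sub by auto
    next
      fix z assume z: "z \<in> topspace T"
      have "z \<in> {z} \<and> {z} \<in> P" if "z \<in> F" using that z unfolding P_def by blast
      moreover have "z \<in> gap F z \<and> gap F z \<in> P" if "z \<notin> F" using that z self unfolding P_def by blast
      ultimately show "z \<in> \<Union>P" by blast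
    qed
    show "disjnt A A'" if "A \<in> P" "A' \<in> P" "A \<noteq> A'" for A A'
    proof (rule ccontr)
      assume "\<not> disjnt A A'"
      then obtain z where z: "z \<in> A" "z \<in> A'" unfolding disjnt_def by blast
      have "w \<notin> gap F x" if "w \<in> F" for w x using that unfolding mem_gap by blast
      then show False using that z gap_eq unfolding P_def by blast
    qed
    show "{} \<notin> P" using self unfolding P_def by blast
  qed
  moreover have "finite P"
    unfolding P_def using F finite_gaps[OF F] by (meson finite_Int finite_UnI finite_imageI finite_subset image_mono subset_UNIV)
  moreover have "point_or_interval Y \<and>
       (subtopology T Y = order_topology_on Y \<or>
        subtopology T Y = right_half_open_topology_on Y \<or>
        subtopology T Y = left_half_open_topology_on Y \<or>
        subtopology T Y = discrete_topology Y)" if Y: "Y \<in> P" for Y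
  proof -
    consider a where "Y = {a}" "a \<in> topspace T" | x where "x \<in> topspace T" "x \<notin> F" "Y = gap F x"
      using Y unfolding P_def by blast
    then show ?thesis
    proof cases
      case 1
      then show ?thesis using subtopology_singleton[of a T] unfolding point_or_interval_def by blast
    next
      case 2
      then show ?thesis
        using piece[of x Y] open_interval_gap[OF F, of x] unfolding point_or_interval_def by blast
    qed
  qed
  ultimately show ?thesis by blast
qed

end
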